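(* Let $(M,\varphi,\xi,\eta,g)$ be an almost paracontact almost paracomplex Riemannian manifold and let $\alpha,\beta$ be smooth functions on $M$. Then there exists a unique linear connection $\overline{\nabla}$ on $M$ satisfying both $$\overline{\nabla}_xy-\overline{\nabla}_yx-[x,y]=\alpha\{\eta(x)y-\eta(y)x\}+\beta\{\eta(x)\varphi y-\eta(y)\varphi x\}$$ for all vector fields $x,y$ on $M$, and $$(\overline{\nabla}_xg)(y,z)=0$$ for all vector fields $x,y,z$ on $M$.
   Context: An almost paracontact almost paracomplex Riemannian manifold (apapR manifold) $(M,\varphi,\xi,\eta,g)$ is a differentiable manifold $M$ of dimension $2n+1$ with a $(1,1)$-tensor field $\varphi$, a vector field $\xi$, a $1$-form $\eta$ and a Riemannian metric $g$ such that, for all vector fields $x,y$: $\eta(\xi)=1$, $\varphi^2x=x-\eta(x)\xi$, $\varphi\xi=0$, $g(\varphi x,\varphi y)=g(x,y)-\eta(x)\eta(y)$, $\mathrm{tr}\,\varphi=0$. Consequently $g(x,\xi)=\eta(x)$ and $g(x,\varphi y)=g(\varphi x,y)$. *)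

theory Defs
  imports "HOL-Analysis.Analysis" "HOL-Library.Function_Algebras"
begin

instantiation "fun" :: (type, real_vector) real_vector
begin
definition "a *\<^sub>R f = (\<lambda>x. a *\<^sub>R f x)"
instance
  by standard (simp_all add: scaleR_fun_def fun_eq_iff scaleR_add_right scaleR_add_left)
end

lemma scaleR_fun_apply [simp]: "(a *\<^sub>R f) x = a *\<^sub>R f x"
  by (simp add: scaleR_fun_def)

section \<open>Smooth manifolds\<close>

text \<open>Only meant for open \<open>S\<close>. As the domain is finite-dimensional, \<open>f\<close> is of class \<open>C^(k+1)\<close> iff it
  is differentiable and all its directional derivatives are of class \<open>C^k\<close>.\<close>

primrec C_k_on :: "nat \<Rightarrow> 'e::euclidean_space set \<Rightarrow> ('e \<Rightarrow> 'f::real_normed_vector) \<Rightarrow> bool" where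
  "C_k_on 0 S f \<longleftrightarrow> continuous_on S f"
| "C_k_on (Suc k) S f \<longleftrightarrow> (\<forall>x\<in>S. f differentiable (at x)) \<and>
     (\<forall>v. C_k_on k S (\<lambda>x. frechet_derivative f (at x) v))"

definition smooth_on :: "'e::euclidean_space set \<Rightarrow> ('e \<Rightarrow> 'f::real_normed_vector) \<Rightarrow> bool" where
  "smooth_on S f \<longleftrightarrow> (\<forall>k. C_k_on k S f)"

text \<open>A chart is a pair \<open>(U, c)\<close> of a domain \<open>U\<close> and a coordinate map \<open>c\<close>, of which only the
  restriction to \<open>U\<close> is relevant. The underlying set of the manifold is the whole type \<open>'a\<close>, and its
  topology is the one given by the class constraints.\<close>

type_synonym ('a, 'e) chart = "'a set \<times> ('a \<Rightarrow> 'e)"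

definition is_chart ::
    "('a::topological_space, 'e::euclidean_space) chart \<Rightarrow> bool" where
  "is_chart = (\<lambda>(U, c). open U \<and> open (c ` U) \<and> homeomorphism U (c ` U) c (inv_into U c))"

definition smooth_atlas ::
    "('a::{t2_space, second_countable_topology}, 'e::euclidean_space) chart set \<Rightarrow> bool" where
  "smooth_atlas A \<longleftrightarrow>
     (\<forall>(U, c)\<in>A. is_chart (U, c)) \<and>
     (\<Union>(U, c)\<in>A. U) = UNIV \<and>
     (\<forall>(U, c)\<in>A. \<forall>(V, d)\<in>A. smooth_on (c ` (U \<inter> V)) (d \<circ> inv_into U c))"

definition smooth_functions ::
    "('a::{t2_space, second_countable_topology}, 'e::euclidean_space) chart set \<Rightarrow> ('a \<Rightarrow> real) set" where
  "smooth_functions A = {f. \<forall>(U, c)\<in>A. smooth_on (c ` U) (f \<circ> inv_into U c)}"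

section \<open>Tangent vectors and vector fields\<close>

text \<open>Tangent vectors at \<open>p\<close> are the derivations at \<open>p\<close> of the algebra of smooth functions. As HOL
  functions are total, they are normalised to be \<open>0\<close> on non-smooth functions, so that equality of
  derivations is equality in HOL.\<close>

type_synonym 'a tvec = "('a \<Rightarrow> real) \<Rightarrow> real"

definition tangent_space ::
    "('a::{t2_space, second_countable_topology}, 'e::euclidean_space) chart set \<Rightarrow> 'a \<Rightarrow> 'a tvec set" where
  "tangent_space A p = {v.
     (\<forall>f\<in>smooth_functions A. \<forall>h\<in>smooth_functions A. v (f + h) = v f + v h) \<and>
     (\<forall>a. \<forall>f\<in>smooth_functions A. v (a *\<^sub>R f) = a * v f) \<and>
     (\<forall>f\<in>smooth_functions A. \<forall>h\<in>smooth_functions A. v (f * h) = f p * v h + h p * v f) \<and>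
     (\<forall>f. f \<notin> smooth_functions A \<longrightarrow> v f = 0)}"

type_synonym 'a vfield = "'a \<Rightarrow> 'a tvec"

definition dir_deriv :: "'a vfield \<Rightarrow> ('a \<Rightarrow> real) \<Rightarrow> 'a \<Rightarrow> real" where
  "dir_deriv X f = (\<lambda>p. X p f)"

definition vector_fields ::
    "('a::{t2_space, second_countable_topology}, 'e::euclidean_space) chart set \<Rightarrow> 'a vfield set" where
  "vector_fields A = {X. (\<forall>p. X p \<in> tangent_space A p) \<and>
     (\<forall>f\<in>smooth_functions A. dir_deriv X f \<in> smooth_functions A)}"

definition fun_scale :: "('a \<Rightarrow> real) \<Rightarrow> 'a vfield \<Rightarrow> 'a vfield" (infixr "*\<^sub>F" 75) where
  "f *\<^sub>F X = (\<lambda>p. f p *\<^sub>R X p)"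

definition lie_bracket :: "'a vfield \<Rightarrow> 'a vfield \<Rightarrow> 'a vfield" where
  "lie_bracket X Y = (\<lambda>p f. X p (dir_deriv Y f) - Y p (dir_deriv X f))"

section \<open>Tensor fields\<close>

text \<open>A tensor field is a family of (multi)linear maps on the tangent spaces; its values outside the
  tangent spaces are irrelevant. It is smooth iff it maps vector fields to smooth functions or
  vector fields, respectively. With the following operator, \<open>g \<odot> X \<odot> Y\<close> is the function \<open>g(X, Y)\<close>.\<close>

definition apply_field :: "('a \<Rightarrow> 'b \<Rightarrow> 'c) \<Rightarrow> ('a \<Rightarrow> 'b) \<Rightarrow> 'a \<Rightarrow> 'c" (infixl "\<odot>" 80) where
  "T \<odot> X = (\<lambda>p. T p (X p))"

definition linear_on_subspace :: "'v::real_vector set \<Rightarrow> ('v \<Rightarrow> 'w::real_vector) \<Rightarrow> bool" where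
  "linear_on_subspace S L \<longleftrightarrow>
     (\<forall>u\<in>S. \<forall>v\<in>S. L (u + v) = L u + L v) \<and> (\<forall>a. \<forall>u\<in>S. L (a *\<^sub>R u) = a *\<^sub>R L u)"

definition one_form ::
    "('a::{t2_space, second_countable_topology}, 'e::euclidean_space) chart set
      \<Rightarrow> ('a \<Rightarrow> 'a tvec \<Rightarrow> real) \<Rightarrow> bool" where
  "one_form A \<omega> \<longleftrightarrow>
     (\<forall>p. linear_on_subspace (tangent_space A p) (\<omega> p)) \<and>
     (\<forall>X\<in>vector_fields A. \<omega> \<odot> X \<in> smooth_functions A)"

definition tensor_field_1_1 ::
    "('a::{t2_space, second_countable_topology}, 'e::euclidean_space) chart set
      \<Rightarrow> ('a \<Rightarrow> 'a tvec \<Rightarrow> 'a tvec) \<Rightarrow> bool" where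
  "tensor_field_1_1 A T \<longleftrightarrow>
     (\<forall>p. T p ` tangent_space A p \<subseteq> tangent_space A p \<and>
          linear_on_subspace (tangent_space A p) (T p)) \<and>
     (\<forall>X\<in>vector_fields A. T \<odot> X \<in> vector_fields A)"

definition riemannian_metric ::
    "('a::{t2_space, second_countable_topology}, 'e::euclidean_space) chart set
      \<Rightarrow> ('a \<Rightarrow> 'a tvec \<Rightarrow> 'a tvec \<Rightarrow> real) \<Rightarrow> bool" where
  "riemannian_metric A g \<longleftrightarrow>
     (\<forall>p. \<forall>u\<in>tangent_space A p. linear_on_subspace (tangent_space A p) (g p u)) \<and>
     (\<forall>p. \<forall>u\<in>tangent_space A p. \<forall>v\<in>tangent_space A p. g p u v = g p v u) \<and>
     (\<forall>p. \<forall>u\<in>tangent_space A p. u \<noteq> 0 \<longrightarrow> g p u u > 0) \<and>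
     (\<forall>X\<in>vector_fields A. \<forall>Y\<in>vector_fields A. g \<odot> X \<odot> Y \<in> smooth_functions A)"

text \<open>Trace of an endomorphism \<open>L\<close> of a finite-dimensional subspace \<open>S\<close>: the sum of the diagonal
  entries of the matrix of \<open>L\<close> with respect to a basis of \<open>S\<close> (independent of its choice).\<close>

definition trace_on :: "'v::real_vector set \<Rightarrow> ('v \<Rightarrow> 'v) \<Rightarrow> real" where
  "trace_on S L =
     (let B = (SOME B. B \<subseteq> S \<and> independent B \<and> S \<subseteq> span B)
      in \<Sum>b\<in>B. representation B (L b) b)"

section \<open>Almost paracontact almost paracomplex Riemannian manifolds\<close>

locale apapR_manifold =
  fixes n :: nat
    and A :: "('a::{t2_space, second_countable_topology}, 'e::euclidean_space) chart set"
    and \<phi> :: "'a \<Rightarrow> 'a tvec \<Rightarrow> 'a tvec"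
    and \<xi> :: "'a vfield"
    and \<eta> :: "'a \<Rightarrow> 'a tvec \<Rightarrow> real"
    and g :: "'a \<Rightarrow> 'a tvec \<Rightarrow> 'a tvec \<Rightarrow> real"
  assumes atlas: "smooth_atlas A"
    and dimension: "DIM('e) = 2 * n + 1"
    and phi_tensor: "tensor_field_1_1 A \<phi>"
    and xi_field: "\<xi> \<in> vector_fields A"
    and eta_form: "one_form A \<eta>"
    and metric: "riemannian_metric A g"
    and eta_xi: "\<eta> \<odot> \<xi> = 1"
    and phi_phi: "x \<in> vector_fields A \<Longrightarrow> \<phi> \<odot> (\<phi> \<odot> x) = x - (\<eta> \<odot> x) *\<^sub>F \<xi>"
    and phi_xi: "\<phi> \<odot> \<xi> = 0"
    and metric_phi: "x \<in> vector_fields A \<Longrightarrow> y \<in> vector_fields A \<Longrightarrow>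
      g \<odot> (\<phi> \<odot> x) \<odot> (\<phi> \<odot> y) = g \<odot> x \<odot> y - (\<eta> \<odot> x) * (\<eta> \<odot> y)"
    and trace_phi: "trace_on (tangent_space A p) (\<phi> p) = 0"

section \<open>Linear connections\<close>

text \<open>The last condition only normalises the values on arguments that are not vector fields, so
  that connections are equal in HOL iff they agree on vector fields.\<close>

definition linear_connection ::
    "('a::{t2_space, second_countable_topology}, 'e::euclidean_space) chart set
      \<Rightarrow> ('a vfield \<Rightarrow> 'a vfield \<Rightarrow> 'a vfield) \<Rightarrow> bool" where
  "linear_connection A D \<longleftrightarrow>
     (\<forall>x\<in>vector_fields A. \<forall>y\<in>vector_fields A. D x y \<in> vector_fields A) \<and>
     (\<forall>x\<in>vector_fields A. \<forall>x'\<in>vector_fields A. \<forall>y\<in>vector_fields A.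
        D (x + x') y = D x y + D x' y) \<and>
     (\<forall>f\<in>smooth_functions A. \<forall>x\<in>vector_fields A. \<forall>y\<in>vector_fields A.
        D (f *\<^sub>F x) y = f *\<^sub>F D x y) \<and>
     (\<forall>x\<in>vector_fields A. \<forall>y\<in>vector_fields A. \<forall>y'\<in>vector_fields A.
        D x (y + y') = D x y + D x y') \<and>
     (\<forall>f\<in>smooth_functions A. \<forall>x\<in>vector_fields A. \<forall>y\<in>vector_fields A.
        D x (f *\<^sub>F y) = dir_deriv x f *\<^sub>F y + f *\<^sub>F D x y) \<and>
     (\<forall>x y. x \<notin> vector_fields A \<or> y \<notin> vector_fields A \<longrightarrow> D x y = 0)"

definition cov_deriv_metric ::
    "('a vfield \<Rightarrow> 'a vfield \<Rightarrow> 'a vfield) \<Rightarrow> ('a \<Rightarrow> 'a tvec \<Rightarrow> 'a tvec \<Rightarrow> real)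
      \<Rightarrow> 'a vfield \<Rightarrow> 'a vfield \<Rightarrow> 'a vfield \<Rightarrow> 'a \<Rightarrow> real" where
  "cov_deriv_metric D g x y z = dir_deriv x (g \<odot> y \<odot> z) - g \<odot> D x y \<odot> z - g \<odot> y \<odot> D x z"

end

theory Submission
  imports Defs "HOL-Computational_Algebra.Polynomial"
begin

text \<open>Adding the prescribed torsion to the Lie bracket gives a bracket \<open>B\<close> which is still skew and
  satisfies the Leibniz rule, and this is all that the Koszul formula needs: it shows that a metric
  connection \<open>D\<close> with \<open>D x y - D y x = B x y\<close> must have \<open>2 g(D x y, z) = K x y z\<close> for an expression \<open>K\<close>
  linear over smooth functions in \<open>z\<close>, whence uniqueness. For existence one needs a vector field
  representing such a linear form. Since tangent vectors are derivations of the algebra of global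
  smooth functions, bump functions and Hadamard's lemma are used to build, around each point, global
  vector fields that span every vector field up to a smooth factor. Gram-Schmidt then represents
  \<open>\<rho>\<close> times the linear form for some smooth \<open>\<rho>\<close> not vanishing at the point, and
  the quotients by the various \<open>\<rho>\<close> agree by nondegeneracy of the metric.\<close>

text \<open>The obstacle is that derivations act on global functions only. Coordinates, coordinate
  fields and coefficients become available only after multiplication by a bump function, and
  dividing it out again would leave the algebra of global smooth functions, because it vanishes off
  a ball. Every local identity is therefore kept multiplied by its denominators, which makes it an
  equation between global objects. The division that yields the representing field happens only at
  the end and pointwise: the vector at \<open>q\<close> is divided by the value at \<open>q\<close>
  of the factor that belongs to \<open>q\<close>. The result is smooth because its product with each
  factor is a vector field, and near its own point that factor is invertible. This takes the place
  of a partition of unity.\<close>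

section \<open>Smooth functions on Euclidean space\<close>

lemma C_k_on_cong:
  assumes "open S" "\<And>x. x \<in> S \<Longrightarrow> f x = g x"
  shows "C_k_on k S f \<longleftrightarrow> C_k_on k S g"
  using assms(2)
proof (induction k arbitrary: f g)
  case 0
  then show ?case by (auto cong: continuous_on_cong)
next
  case (Suc k)
  have d: "(f has_derivative D) (at x) \<longleftrightarrow> (g has_derivative D) (at x)" if "x \<in> S" for x D
    using has_derivative_transform_within_open[OF _ assms(1) that] Suc.prems by metis
  \<comment> \<open>\<open>frechet_derivative\<close> is a Hilbert choice. By \<open>d\<close> both
    choices are made from the same predicate, so they coincide even at points where neither function
    is differentiable.\<close>
  have fd: "frechet_derivative f (at x) = frechet_derivative g (at x)" if "x \<in> S" for x
    unfolding frechet_derivative_def using d[OF that] by simp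
  have "C_k_on k S (\<lambda>x. frechet_derivative f (at x) v) \<longleftrightarrow>
        C_k_on k S (\<lambda>x. frechet_derivative g (at x) v)" for v
    by (rule Suc.IH) (simp add: fd)
  then show ?case using d by (auto simp: differentiable_def)
qed

lemma C_k_on_SucI:
  assumes "open S" "\<And>x. x \<in> S \<Longrightarrow> (f has_derivative f' x) (at x)"
    and "\<And>v. C_k_on k S (\<lambda>x. f' x v)"
  shows "C_k_on (Suc k) S f"
proof -
  have "C_k_on k S (\<lambda>x. frechet_derivative f (at x) v)" for v
    using C_k_on_cong[OF assms(1), of "\<lambda>x. frechet_derivative f (at x) v" "\<lambda>x. f' x v" k]
      frechet_derivative_at[OF assms(2)] assms(3) by simp
  then show ?thesis using assms(2) by (auto simp: differentiable_def)
qed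

lemma C_k_on_SucD:
  assumes "C_k_on (Suc k) S f"
  shows "x \<in> S \<Longrightarrow> (f has_derivative frechet_derivative f (at x)) (at x)"
    and "C_k_on k S (\<lambda>x. frechet_derivative f (at x) v)"
  using assms by (auto simp: frechet_derivative_works[symmetric])

lemma C_k_on_Suc_imp: "C_k_on (Suc k) S f \<Longrightarrow> C_k_on k S f"
proof (induction k arbitrary: f)
  case 0
  then show ?case
    by (auto intro!: differentiable_imp_continuous_on differentiable_at_imp_differentiable_on)
next
  case (Suc k)
  then show ?case by (auto simp del: C_k_on.simps(1))
qed

lemma C_k_on_subset: "C_k_on k S f \<Longrightarrow> T \<subseteq> S \<Longrightarrow> C_k_on k T f"
  by (induction k arbitrary: f) (auto intro: continuous_on_subset)

text \<open>Derivatives are taken \<open>at x\<close> and not within \<open>S\<close>, so passing to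
  a neighbourhood does not change the function that is differentiated next; the local hypothesis is
  inherited by it directly.\<close>

lemma C_k_on_local:
  assumes "\<And>x. x \<in> S \<Longrightarrow> \<exists>T. open T \<and> x \<in> T \<and> C_k_on k T f"
  shows "C_k_on k S f"
  using assms
proof (induction k arbitrary: f)
  case 0
  then have "continuous (at x) f" if "x \<in> S" for x
    using that by (metis C_k_on.simps(1) continuous_on_eq_continuous_at)
  then show ?case by (simp add: continuous_at_imp_continuous_on)
next
  case (Suc k)
  have "C_k_on k S (\<lambda>x. frechet_derivative f (at x) v)" for v
    by (rule Suc.IH) (use Suc.prems C_k_on_SucD(2) in metis)
  then show ?case using Suc.prems by auto
qed

lemma C_k_on_const: "open S \<Longrightarrow> C_k_on k S (\<lambda>_. c)"
proof (induction k arbitrary: c)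
  case (Suc k)
  show ?case by (rule C_k_on_SucI[of _ _ "\<lambda>_ _. 0"]) (use Suc in auto)
qed simp

lemma C_k_on_bounded_linear:
  assumes "open S" "bounded_linear f" shows "C_k_on k S f"
proof (cases k)
  case 0
  then show ?thesis using assms linear_continuous_on by auto
next
  case (Suc j)
  show ?thesis unfolding Suc
    by (rule C_k_on_SucI[of _ _ "\<lambda>_. f"])
       (use assms C_k_on_const bounded_linear_imp_has_derivative in auto)
qed

lemma C_k_on_add:
  assumes "open S" "C_k_on k S f" "C_k_on k S g"
  shows "C_k_on k S (\<lambda>x. f x + g x)"
  using assms(2,3)
proof (induction k arbitrary: f g)
  case (Suc k)
  note D = C_k_on_SucD[OF Suc.prems(1)] C_k_on_SucD[OF Suc.prems(2)]
  show ?case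
    by (rule C_k_on_SucI[OF assms(1) has_derivative_add[OF D(1) D(3)]]) (auto intro: Suc.IH D)
qed (simp add: continuous_on_add)

lemma (in bounded_bilinear) C_k_on:
  fixes f :: "'e::euclidean_space \<Rightarrow> 'a"
  assumes "open S" "C_k_on k S f" "C_k_on k S g"
  shows "C_k_on k S (\<lambda>x. prod (f x) (g x))"
  using assms(2,3)
proof (induction k arbitrary: f g)
  case 0
  then show ?case by (auto intro: continuous_on)
next
  case (Suc k)
  note D = C_k_on_SucD[OF Suc.prems(1)] C_k_on_SucD[OF Suc.prems(2)]
  show ?case
    by (rule C_k_on_SucI[OF assms(1) FDERIV[OF D(1) D(3)]])
       (auto intro!: C_k_on_add assms(1) Suc.IH D(2,4) Suc.prems[THEN C_k_on_Suc_imp])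
qed

lemmas C_k_on_mult = bounded_bilinear.C_k_on[OF bounded_bilinear_mult]
  and C_k_on_scaleR = bounded_bilinear.C_k_on[OF bounded_bilinear_scaleR]
  and C_k_on_inner = bounded_bilinear.C_k_on[OF bounded_bilinear_inner]

lemma C_k_on_sum:
  "open S \<Longrightarrow> (\<And>i. i \<in> I \<Longrightarrow> C_k_on k S (f i)) \<Longrightarrow> C_k_on k S (\<lambda>x. \<Sum>i\<in>I. f i x)"
  by (induction I rule: infinite_finite_induct) (auto intro: C_k_on_add C_k_on_const)

lemma C_k_on_inverse:
  fixes f :: "'e::euclidean_space \<Rightarrow> real"
  assumes "open S" "C_k_on k S f" "\<And>x. x \<in> S \<Longrightarrow> f x \<noteq> 0"
  shows "C_k_on k S (\<lambda>x. inverse (f x))"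
  using assms(2)
proof (induction k)
  case 0
  then show ?case using assms(3) by (auto intro: continuous_on_inverse)
next
  case (Suc k)
  note D = C_k_on_SucD[OF Suc.prems]
  have I: "C_k_on k S (\<lambda>x. inverse (f x))"
    using Suc C_k_on_Suc_imp by blast
  show ?case
  proof (rule C_k_on_SucI[OF assms(1) Deriv.has_derivative_inverse[OF assms(3) D(1)]])
    fix v
    have "C_k_on k S (\<lambda>x. (- 1) * (inverse (f x) * frechet_derivative f (at x) v * inverse (f x)))"
      by (intro C_k_on_mult C_k_on_const assms(1) I D(2))
    then show "C_k_on k S (\<lambda>x. - (inverse (f x) * frechet_derivative f (at x) v * inverse (f x)))"
      by simp
  qed
qed

lemma C_k_on_compose:
  fixes g :: "'d::euclidean_space \<Rightarrow> 'e::euclidean_space"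
  assumes "open S" "open T" "g ` S \<subseteq> T" "C_k_on k S g" "C_k_on k T f"
  shows "C_k_on k S (f \<circ> g)"
  using assms(4,5)
proof (induction k arbitrary: f)
  case 0
  then show ?case using assms(3) by (simp add: continuous_on_compose2 o_def)
next
  case (Suc k)
  note D = C_k_on_SucD[OF Suc.prems(1)] C_k_on_SucD[OF Suc.prems(2)]
  have gk: "C_k_on k S g" using Suc.prems(1) C_k_on_Suc_imp by blast
  \<comment> \<open>The chain rule applies the derivative of \<open>f\<close> to a direction that
    varies with \<open>x\<close>, whereas \<open>C_k_on\<close> speaks of fixed directions.
    Expanding in \<open>Basis\<close> leaves fixed directions \<open>b\<close> with scalar
    coefficients, so the induction hypothesis and the product rule apply.\<close>
  let ?F = "\<lambda>x v. \<Sum>b\<in>Basis. (frechet_derivative g (at x) v \<bullet> b) *\<^sub>R frechet_derivative f (at (g x)) b"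
  show ?case
  proof (rule C_k_on_SucI[OF assms(1), of _ ?F])
    fix x assume "x \<in> S"
    then have gx: "g x \<in> T" using assms(3) by auto
    interpret L: bounded_linear "frechet_derivative f (at (g x))"
      using D(3)[OF gx] by (rule has_derivative_bounded_linear)
    have "?F x = frechet_derivative f (at (g x)) \<circ> frechet_derivative g (at x)"
    proof
      fix v
      have "frechet_derivative f (at (g x)) (\<Sum>b\<in>Basis. (frechet_derivative g (at x) v \<bullet> b) *\<^sub>R b) = ?F x v"
        by (simp add: L.sum L.scaleR)
      then show "?F x v = (frechet_derivative f (at (g x)) \<circ> frechet_derivative g (at x)) v"
        by (simp add: euclidean_representation)
    qed
    then show "(f \<circ> g has_derivative ?F x) (at x)"
      using diff_chain_at[OF D(1)[OF \<open>x \<in> S\<close>] D(3)[OF gx]] by simp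
  next
    fix v
    show "C_k_on k S (\<lambda>x. ?F x v)"
      using Suc.IH[OF gk D(4)]
      by (auto intro!: C_k_on_sum C_k_on_scaleR C_k_on_inner C_k_on_const assms(1) D(2) simp: o_def)
  qed
qed

lemma smooth_onI: "(\<And>k. C_k_on k S f) \<Longrightarrow> smooth_on S f"
  by (simp add: smooth_on_def)

lemma smooth_on_cong:
  "open S \<Longrightarrow> (\<And>x. x \<in> S \<Longrightarrow> f x = g x) \<Longrightarrow> smooth_on S f \<longleftrightarrow> smooth_on S g"
  using C_k_on_cong unfolding smooth_on_def by blast

lemma smooth_on_local:
  "(\<And>x. x \<in> S \<Longrightarrow> \<exists>T. open T \<and> x \<in> T \<and> smooth_on T f) \<Longrightarrow> smooth_on S f"
  unfolding smooth_on_def using C_k_on_local by metis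

lemma smooth_on_subset: "smooth_on S f \<Longrightarrow> T \<subseteq> S \<Longrightarrow> smooth_on T f"
  unfolding smooth_on_def using C_k_on_subset by metis

lemma smooth_on_compose:
  fixes g :: "'d::euclidean_space \<Rightarrow> 'e::euclidean_space"
  assumes "open S" "open T" "g ` S \<subseteq> T" "smooth_on S g" "smooth_on T f"
  shows "smooth_on S (f \<circ> g)"
  using assms C_k_on_compose unfolding smooth_on_def by blast

lemma smooth_on_frechet_derivative:
  assumes "smooth_on S f"
  shows "smooth_on S (\<lambda>x. frechet_derivative f (at x) v)"
    and "x \<in> S \<Longrightarrow> (f has_derivative frechet_derivative f (at x)) (at x)"
  using assms C_k_on_SucD unfolding smooth_on_def by blast+

lemma
  assumes "open S"
  shows smooth_on_const: "smooth_on S (\<lambda>_. c)"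
    and smooth_on_bounded_linear: "bounded_linear l \<Longrightarrow> smooth_on S l"
    and smooth_on_add: "smooth_on S f \<Longrightarrow> smooth_on S g \<Longrightarrow> smooth_on S (\<lambda>x. f x + g x)"
    and smooth_on_inner: "smooth_on S u \<Longrightarrow> smooth_on S w \<Longrightarrow> smooth_on S (\<lambda>x. u x \<bullet> w x)"
  using assms unfolding smooth_on_def
  by (blast intro: C_k_on_const C_k_on_bounded_linear C_k_on_add C_k_on_inner)+

lemma
  fixes f g :: "'e::euclidean_space \<Rightarrow> real"
  assumes "open S" "smooth_on S f"
  shows smooth_on_mult: "smooth_on S g \<Longrightarrow> smooth_on S (\<lambda>x. f x * g x)"
    and smooth_on_inverse: "(\<And>x. x \<in> S \<Longrightarrow> f x \<noteq> 0) \<Longrightarrow> smooth_on S (\<lambda>x. inverse (f x))"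
  using assms unfolding smooth_on_def by (blast intro: C_k_on_mult C_k_on_inverse)+

section \<open>Bump functions and Hadamard's lemma\<close>

text \<open>The family is closed under differentiation, which gives smoothness at \<open>0\<close> by induction.\<close>

definition flat :: "real poly \<Rightarrow> real \<Rightarrow> real" where
  "flat p t = (if t > 0 then poly p (inverse t) * exp (- inverse t) else 0)"

lemma tendsto_poly_times_exp_minus: "((\<lambda>x::real. poly p x * exp (- x)) \<longlongrightarrow> 0) at_top"
proof -
  have "((\<lambda>x. \<Sum>i\<le>degree p. coeff p i * (x ^ i / exp x)) \<longlongrightarrow> (\<Sum>i\<le>degree p. coeff p i * 0)) at_top"
    by (intro tendsto_intros tendsto_power_div_exp_0)
  then show ?thesis
    by (simp add: poly_altdef sum_distrib_right exp_minus divide_inverse mult.assoc)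
qed

text \<open>With s = 1/t, d/dt is -s^2 d/ds, and d/ds turns p(s) exp(-s) into (p' - p)(s) exp(-s);
  \<open>[:0, 0, 1:]\<close> is s^2. At 0 the difference quotient from the right is s p(s) exp(-s),
  which tends to 0 as s grows.\<close>

lemma flat_has_field_derivative:
  "(flat p has_field_derivative flat ((p - pderiv p) * [:0, 0, 1:]) t) (at t)"
proof -
  consider "t > 0" | "t < 0" | "t = 0" by linarith
  then show ?thesis
  proof cases
    case 1
    have "((\<lambda>t. poly p (inverse t) * exp (- inverse t)) has_field_derivative
        flat ((p - pderiv p) * [:0, 0, 1:]) t) (at t)"
      using 1 by (auto intro!: derivative_eq_intros DERIV_chain2[OF poly_DERIV]
          simp: flat_def field_simps power2_eq_square)
    then show ?thesis
      by (rule has_field_derivative_transform_within_open[of _ _ _ "{0<..}"])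
         (use 1 in \<open>auto simp: flat_def\<close>)
  next
    case 2
    have "((\<lambda>t. 0) has_field_derivative flat ((p - pderiv p) * [:0, 0, 1:]) t) (at t)"
      using 2 by (simp add: flat_def)
    then show ?thesis
      by (rule has_field_derivative_transform_within_open[of _ _ _ "{..<0}"])
         (use 2 in \<open>auto simp: flat_def\<close>)
  next
    case 3
    have "((\<lambda>h. poly (p * [:0, 1:]) (inverse h) * exp (- inverse h)) \<longlongrightarrow> 0) (at_right 0)"
      using filterlim_compose[OF tendsto_poly_times_exp_minus filterlim_inverse_at_top_right] .
    then have R: "((\<lambda>h. (flat p (0 + h) - flat p 0) / h) \<longlongrightarrow> 0) (at_right 0)"
      by (rule Lim_transform_eventually)
         (auto simp: flat_def field_simps eventually_at_right_less intro!: eventually_at_rightI[of 0 1])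
    have L: "((\<lambda>h. (flat p (0 + h) - flat p 0) / h) \<longlongrightarrow> 0) (at_left 0)"
      by (rule tendsto_eventually) (auto simp: flat_def intro!: eventually_at_leftI[of "-1" 0])
    show ?thesis
      using filterlim_split_at[OF L R] 3 by (simp add: DERIV_def flat_def)
  qed
qed

lemma C_k_on_flat: "C_k_on k UNIV (flat p)"
proof (induction k arbitrary: p)
  case 0
  then show ?case
    using DERIV_isCont[OF flat_has_field_derivative]
    by (simp add: continuous_at_imp_continuous_on del: mult_pCons_right)
next
  case (Suc k)
  show ?case
    by (rule C_k_on_SucI[OF open_UNIV flat_has_field_derivative[unfolded has_field_derivative_def]])
       (intro C_k_on_mult C_k_on_const Suc open_UNIV)
qed

text \<open>Squared distances keep the argument of \<open>flat\<close> smooth at the centre. There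
  is no plateau on which the bump equals 1, so powers of it remain in the identities built from
  it.\<close>

definition bump :: "'e::euclidean_space \<Rightarrow> real \<Rightarrow> 'e \<Rightarrow> real" where
  "bump a r x = flat 1 (r\<^sup>2 - (x - a) \<bullet> (x - a))"

lemma bump_eq_0_iff:
  assumes "r > 0"
  shows "bump a r x = 0 \<longleftrightarrow> x \<notin> ball a r"
proof -
  have "x \<in> ball a r \<longleftrightarrow> (norm (x - a))\<^sup>2 < r\<^sup>2"
    using assms power_mono_iff[of r "norm (x - a)" 2]
    by (auto simp: dist_norm norm_minus_commute not_le[symmetric])
  then show ?thesis by (simp add: bump_def flat_def power2_norm_eq_inner)
qed

lemma smooth_on_bump: "open S \<Longrightarrow> smooth_on S (bump a r)"
proof -
  assume S: "open S"
  have id: "smooth_on S (\<lambda>x. x - a)"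
    using smooth_on_add[OF S smooth_on_bounded_linear[OF S bounded_linear_ident]
        smooth_on_const[OF S, of "-a"]] by simp
  have "smooth_on S (\<lambda>x. r\<^sup>2 + (-1) * ((x - a) \<bullet> (x - a)))"
    by (intro smooth_on_add smooth_on_mult smooth_on_const smooth_on_inner S id)
  then have "smooth_on S (flat 1 \<circ> (\<lambda>x. r\<^sup>2 - (x - a) \<bullet> (x - a)))"
    by (intro smooth_on_compose[OF S open_UNIV]) (auto simp: smooth_on_def C_k_on_flat)
  then show ?thesis by (simp add: bump_def[abs_def] o_def)
qed

text \<open>For \<open>m = 0\<close> and \<open>F\<close> a partial derivative of f, this is the
  coefficient in Hadamard's lemma. Differentiating under the integral in \<open>x\<close> brings out
  a factor t; the weight \<open>t ^ m\<close> absorbs it, so that the family is closed under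
  differentiation.\<close>

definition radial_integral :: "'e::euclidean_space \<Rightarrow> nat \<Rightarrow> ('e \<Rightarrow> real) \<Rightarrow> 'e \<Rightarrow> real" where
  "radial_integral q m F x = integral {0..1} (\<lambda>t. t ^ m * F (q + t *\<^sub>R (x - q)))"

lemma convex_segment_in:
  fixes q x :: "'e::real_vector"
  assumes "convex S" "q \<in> S" "x \<in> S" "t \<in> {0..1}"
  shows "q + t *\<^sub>R (x - q) \<in> S"
  using convexD[OF assms(1-3), of "1 - t" t] assms(4) by (simp add: algebra_simps)

lemma smooth_on_imp_continuous_on: "smooth_on S f \<Longrightarrow> continuous_on S f"
  using C_k_on.simps(1) unfolding smooth_on_def by blast

lemma radial_integral_has_derivative:
  fixes F :: "'e::euclidean_space \<Rightarrow> real"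
  assumes S: "open S" "convex S" "q \<in> S" and F: "smooth_on S F" and x: "x \<in> S"
  shows "(radial_integral q m F has_derivative
    (\<lambda>v. radial_integral q (Suc m) (\<lambda>y. frechet_derivative F (at y) v) x)) (at x)"
proof -
  \<comment> \<open>\<open>leibniz_rule\<close> asks for the derivative as a continuous family of
    bounded operators. In finite dimension continuity in operator norm can be checked on the basis
    vectors, which reduces it to continuity of partial derivatives.\<close>
  define fx where "fx = (\<lambda>x t. Blinfun (\<lambda>v. t ^ Suc m * frechet_derivative F (at (q + t *\<^sub>R (x - q))) v))"
  note seg = convex_segment_in[OF S(2,3)]
  have blF: "bounded_linear (frechet_derivative F (at (q + t *\<^sub>R (y - q))))"
    if "y \<in> S" "t \<in> {0..1}" for y t
    using smooth_on_frechet_derivative(2)[OF F seg[OF that]] by (rule has_derivative_bounded_linear)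
  have fx: "blinfun_apply (fx y t) v = t ^ Suc m * frechet_derivative F (at (q + t *\<^sub>R (y - q))) v"
    if "y \<in> S" "t \<in> {0..1}" for y t v
    unfolding fx_def using blF[OF that]
    by (subst bounded_linear_Blinfun_apply) (auto intro: bounded_linear_const_mult)
  have cont: "continuous_on (S \<times> {0..1}) (\<lambda>p. q + snd p *\<^sub>R (fst p - q))"
    by (intro continuous_intros)
  have cF: "continuous_on (S \<times> {0..1}) (\<lambda>p. G (q + snd p *\<^sub>R (fst p - q)))"
    if "smooth_on S G" for G :: "'e \<Rightarrow> real"
    using seg by (intro continuous_on_compose2[OF smooth_on_imp_continuous_on[OF that] cont]) auto
  have cfx: "continuous_on (S \<times> {0..1}) (\<lambda>(y, t). fx y t)"
  proof (rule continuous_on_blinfun_componentwise)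
    fix i :: 'e
    have "continuous_on (S \<times> {0..1})
        (\<lambda>p. snd p ^ Suc m * frechet_derivative F (at (q + snd p *\<^sub>R (fst p - q))) i)"
      by (intro continuous_intros cF smooth_on_frechet_derivative(1)[OF F])
    then show "continuous_on (S \<times> {0..1}) (\<lambda>p. blinfun_apply (case p of (y, t) \<Rightarrow> fx y t) i)"
      by (rule continuous_on_eq) (auto simp: fx simp del: power_Suc)
  qed
  have cG: "continuous_on {0..1} (\<lambda>t. G (q + t *\<^sub>R (y - q)))"
    if "smooth_on S G" "y \<in> S" for G :: "'e \<Rightarrow> real" and y
    by (rule continuous_on_compose2[OF smooth_on_imp_continuous_on[OF that(1)]])
       (use seg[OF that(2)] in \<open>auto intro!: continuous_intros\<close>)
  have "((\<lambda>x. integral (cbox 0 1) (\<lambda>t. t ^ m * F (q + t *\<^sub>R (x - q)))) has_derivative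
      blinfun_apply (integral (cbox 0 1) (fx x))) (at x within S)"
  proof (rule leibniz_rule[OF _ _ _ x S(2)])
    show "(\<lambda>t. t ^ m * F (q + t *\<^sub>R (y - q))) integrable_on cbox 0 1" if "y \<in> S" for y
      unfolding cbox_interval by (intro integrable_continuous_interval continuous_intros cG F that)
    show "continuous_on (S \<times> cbox 0 1) (\<lambda>(y, t). fx y t)"
      using cfx by (simp add: cbox_interval)
    fix y and t :: real assume y: "y \<in> S" and "t \<in> cbox 0 1"
    then have t: "t \<in> {0..1}" by (simp add: cbox_interval)
    interpret L: bounded_linear "frechet_derivative F (at (q + t *\<^sub>R (y - q)))"
      by (rule blF[OF y t])
    have "((\<lambda>x. q + t *\<^sub>R (x - q)) has_derivative (\<lambda>v. t *\<^sub>R v)) (at y within S)"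
      by (auto intro!: derivative_eq_intros)
    from has_derivative_compose[OF this smooth_on_frechet_derivative(2)[OF F seg[OF y t]]]
    have "((\<lambda>x. t ^ m * F (q + t *\<^sub>R (x - q))) has_derivative
        (\<lambda>v. t ^ m * frechet_derivative F (at (q + t *\<^sub>R (y - q))) (t *\<^sub>R v))) (at y within S)"
      by (rule has_derivative_mult_right)
    moreover have "blinfun_apply (fx y t) = (\<lambda>v. t ^ m * frechet_derivative F (at (q + t *\<^sub>R (y - q))) (t *\<^sub>R v))"
      by (simp add: fx[OF y t] fun_eq_iff L.scaleR mult_ac)
    ultimately show "((\<lambda>x. t ^ m * F (q + t *\<^sub>R (x - q))) has_derivative blinfun_apply (fx y t)) (at y within S)"
      by simp
  qed
  moreover
  have "blinfun_apply (integral (cbox 0 1) (fx x)) v =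
      radial_integral q (Suc m) (\<lambda>y. frechet_derivative F (at y) v) x" for v
  proof -
    have "continuous_on {0..1} (\<lambda>t. (\<lambda>(y, t). fx y t) (x, t))"
      by (rule continuous_on_compose2[OF cfx]) (use x in \<open>auto intro!: continuous_intros\<close>)
    then have "fx x integrable_on {0..1}"
      using integrable_continuous_interval by auto
    from integral_linear[OF this blinfun.bounded_linear_left, of v]
    have "blinfun_apply (integral {0..1} (fx x)) v = integral {0..1} (\<lambda>t. blinfun_apply (fx x t) v)"
      by (simp add: o_def)
    also have "\<dots> = radial_integral q (Suc m) (\<lambda>y. frechet_derivative F (at y) v) x"
      unfolding radial_integral_def by (rule integral_cong) (simp add: fx[OF x])
    finally show ?thesis by (simp add: cbox_interval)
  qed
  then have "blinfun_apply (integral (cbox 0 1) (fx x)) =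
      (\<lambda>v. radial_integral q (Suc m) (\<lambda>y. frechet_derivative F (at y) v) x)" ..
  ultimately show ?thesis
    using at_within_open[OF x S(1)] by (simp add: radial_integral_def[of q m F, abs_def] cbox_interval)
qed

lemma smooth_on_radial_integral:
  assumes S: "open S" "convex S" "q \<in> S" and F: "smooth_on S F"
  shows "smooth_on S (radial_integral q m F)"
proof (rule smooth_onI)
  fix k show "C_k_on k S (radial_integral q m F)"
    using F
  proof (induction k arbitrary: m F)
    case 0
    then show ?case
      using has_derivative_continuous[OF radial_integral_has_derivative[OF S]]
      by (simp add: continuous_at_imp_continuous_on)
  next
    case (Suc k)
    show ?case
      by (rule C_k_on_SucI[OF S(1) radial_integral_has_derivative[OF S Suc.prems]])
         (auto intro: Suc.IH smooth_on_frechet_derivative Suc.prems)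
  qed
qed

text \<open>The fundamental theorem of calculus along the segment from \<open>q\<close> to
  \<open>x\<close>, which convexity keeps inside \<open>S\<close>: the derivative along it is linear
  in \<open>x - q\<close>, and the integrals of its coefficients are the functions
  \<open>h b\<close>.\<close>

lemma hadamard:
  fixes f :: "'e::euclidean_space \<Rightarrow> real"
  assumes S: "open S" "convex S" "q \<in> S" and f: "smooth_on S f"
  obtains h where "\<And>b. smooth_on S (h b)"
    and "\<And>b. h b q = frechet_derivative f (at q) b"
    and "\<And>x. x \<in> S \<Longrightarrow> f x = f q + (\<Sum>b\<in>Basis. ((x - q) \<bullet> b) * h b x)"
proof
  let ?d = "\<lambda>b y. frechet_derivative f (at y) b"
  let ?h = "\<lambda>b. radial_integral q 0 (?d b)"
  note sd = smooth_on_frechet_derivative(1)[OF f]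
  show "smooth_on S (?h b)" for b
    by (intro smooth_on_radial_integral S sd)
  show "?h b q = frechet_derivative f (at q) b" for b
    by (simp add: radial_integral_def)
  fix x assume x: "x \<in> S"
  note seg = convex_segment_in[OF S(2,3) x]
  have "((\<lambda>t. \<Sum>b\<in>Basis. ((x - q) \<bullet> b) * ?d b (q + t *\<^sub>R (x - q))) has_integral
      f (q + 1 *\<^sub>R (x - q)) - f (q + 0 *\<^sub>R (x - q))) {0..1}"
  proof (rule fundamental_theorem_of_calculus)
    fix t :: real assume t: "t \<in> {0..1}"
    note df = smooth_on_frechet_derivative(2)[OF f seg[OF t]]
    interpret L: bounded_linear "frechet_derivative f (at (q + t *\<^sub>R (x - q)))"
      using df by (rule has_derivative_bounded_linear)
    have "((\<lambda>t. q + t *\<^sub>R (x - q)) has_derivative (\<lambda>s. s *\<^sub>R (x - q))) (at t within {0..1})"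
      by (auto intro!: derivative_eq_intros)
    from has_derivative_compose[OF this df]
    have "((\<lambda>t. f (q + t *\<^sub>R (x - q))) has_derivative
       (\<lambda>s. s *\<^sub>R frechet_derivative f (at (q + t *\<^sub>R (x - q))) (x - q))) (at t within {0..1})"
      by (simp add: L.scaleR)
    moreover have "frechet_derivative f (at (q + t *\<^sub>R (x - q))) (x - q) =
        (\<Sum>b\<in>Basis. ((x - q) \<bullet> b) * ?d b (q + t *\<^sub>R (x - q)))"
      by (subst (2) euclidean_representation[symmetric]) (simp add: L.sum L.scaleR)
    ultimately show "((\<lambda>t. f (q + t *\<^sub>R (x - q))) has_vector_derivative
       (\<Sum>b\<in>Basis. ((x - q) \<bullet> b) * ?d b (q + t *\<^sub>R (x - q)))) (at t within {0..1})"
      by (simp add: has_vector_derivative_def)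
  qed simp
  then have "f x - f q = integral {0..1} (\<lambda>t. \<Sum>b\<in>Basis. ((x - q) \<bullet> b) * ?d b (q + t *\<^sub>R (x - q)))"
    by (simp add: integral_unique)
  also have "\<dots> = (\<Sum>b\<in>Basis. integral {0..1} (\<lambda>t. ((x - q) \<bullet> b) * ?d b (q + t *\<^sub>R (x - q))))"
  proof (rule integral_sum)
    fix b :: 'e
    have "continuous_on {0..1} (\<lambda>t. ?d b (q + t *\<^sub>R (x - q)))"
      by (rule continuous_on_compose2[OF smooth_on_imp_continuous_on[OF sd]])
         (use seg in \<open>auto intro!: continuous_intros\<close>)
    then show "(\<lambda>t. ((x - q) \<bullet> b) * ?d b (q + t *\<^sub>R (x - q))) integrable_on {0..1}"
      by (intro integrable_continuous_interval continuous_intros)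
  qed simp
  also have "\<dots> = (\<Sum>b\<in>Basis. ((x - q) \<bullet> b) * ?h b x)"
    by (simp add: radial_integral_def)
  finally show "f x = f q + (\<Sum>b\<in>Basis. ((x - q) \<bullet> b) * ?h b x)" by simp
qed

section \<open>Vector fields on a smooth manifold\<close>

lemma fun_scale_apply: "(f *\<^sub>F X) p = f p *\<^sub>R X p"
  by (simp only: fun_scale_def)

lemma fun_scale_apply_apply [simp]: "(f *\<^sub>F X) p h = f p * X p h"
  by (simp only: fun_scale_def scaleR_fun_apply real_scaleR_def)

lemma sum_fun_apply: "(\<Sum>i\<in>I. f i) x = (\<Sum>i\<in>I. f i x)"
  for f :: "'i \<Rightarrow> 'x \<Rightarrow> 'y::comm_monoid_add"
  by (induction I rule: infinite_finite_induct) auto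

locale smooth_manifold =
  fixes A :: "('a::{t2_space, second_countable_topology}, 'e::euclidean_space) chart set"
  assumes atlas: "smooth_atlas A"
begin

abbreviation "\<C> \<equiv> smooth_functions A"
abbreviation "\<X> \<equiv> vector_fields A"
abbreviation "TS \<equiv> tangent_space A"

section \<open>Charts and the algebra of smooth functions\<close>

lemma chartD:
  assumes "(U, c) \<in> A"
  shows "open U" "open (c ` U)" "homeomorphism U (c ` U) c (inv_into U c)"
    and "\<And>m. m \<in> U \<Longrightarrow> inv_into U c (c m) = m"
    and "(V, d) \<in> A \<Longrightarrow> smooth_on (c ` (U \<inter> V)) (d \<circ> inv_into U c)"
proof -
  show "open U" "open (c ` U)" and h: "homeomorphism U (c ` U) c (inv_into U c)"
    using assms atlas unfolding smooth_atlas_def is_chart_def by auto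
  show "inv_into U c (c m) = m" if "m \<in> U" for m
    using homeomorphism_apply1[OF h that] .
  show "smooth_on (c ` (U \<inter> V)) (d \<circ> inv_into U c)" if "(V, d) \<in> A"
    using assms that atlas unfolding smooth_atlas_def by blast
qed

lemma chart_open_image:
  assumes "(U, c) \<in> A" "open V" "V \<subseteq> U" shows "open (c ` V)"
proof -
  have "openin (top_of_set U) V"
    using assms(2,3) by (metis Int_absorb1 openin_open_Int)
  from homeomorphism_imp_open_map[OF chartD(3)[OF assms(1)] this] show ?thesis
    using chartD(2)[OF assms(1)] openin_open_trans by blast
qed

lemma chart_exists: obtains U c where "(U, c) \<in> A" "p \<in> U"
  using atlas unfolding smooth_atlas_def by blast

lemma smooth_functionsD: "f \<in> \<C> \<Longrightarrow> (U, c) \<in> A \<Longrightarrow> smooth_on (c ` U) (f \<circ> inv_into U c)"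
  by (auto simp: smooth_functions_def)

lemma smooth_functionsI:
  "(\<And>U c. (U, c) \<in> A \<Longrightarrow> smooth_on (c ` U) (f \<circ> inv_into U c)) \<Longrightarrow> f \<in> \<C>"
  by (auto simp: smooth_functions_def)

lemma const_smooth [simp]: "(\<lambda>_. a) \<in> \<C>"
  by (rule smooth_functionsI) (auto simp: o_def intro: smooth_on_const chartD)

lemma one_smooth [simp]: "1 \<in> \<C>" and zero_smooth [simp]: "0 \<in> \<C>"
  using const_smooth[of 1] const_smooth[of 0] by (simp_all add: one_fun_def zero_fun_def)

lemma add_smooth [simp]: "f \<in> \<C> \<Longrightarrow> h \<in> \<C> \<Longrightarrow> f + h \<in> \<C>"
  using smooth_on_add[OF chartD(2) smooth_functionsD smooth_functionsD]
  by (intro smooth_functionsI) (simp add: o_def plus_fun_def)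

lemma mult_smooth [simp]: "f \<in> \<C> \<Longrightarrow> h \<in> \<C> \<Longrightarrow> f * h \<in> \<C>"
  using smooth_on_mult[OF chartD(2) smooth_functionsD smooth_functionsD]
  by (intro smooth_functionsI) (simp add: o_def times_fun_def)

lemma scaleR_smooth [simp]: "f \<in> \<C> \<Longrightarrow> a *\<^sub>R f \<in> \<C>"
  using mult_smooth[OF const_smooth[of a]] by (simp add: scaleR_fun_def times_fun_def)

lemma uminus_smooth [simp]: "f \<in> \<C> \<Longrightarrow> - f \<in> \<C>"
  using scaleR_smooth[of f "-1"] by simp

lemma diff_smooth [simp]: "f \<in> \<C> \<Longrightarrow> h \<in> \<C> \<Longrightarrow> f - h \<in> \<C>"
  using add_smooth[of f "- h"] by simp

lemma sum_smooth: "(\<And>i. i \<in> I \<Longrightarrow> f i \<in> \<C>) \<Longrightarrow> (\<Sum>i\<in>I. f i) \<in> \<C>"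
  by (induction I rule: infinite_finite_induct) auto

text \<open>In a chart, \<open>f\<close> is the quotient of \<open>\<rho> * f\<close> by
  \<open>\<rho>\<close> on the open set where \<open>\<rho>\<close> does not vanish. The lemma makes
  a function that is defined by pointwise division smooth again, with a different
  \<open>\<rho>\<close> allowed at each point.\<close>

lemma locally_quotient_smooth:
  assumes "\<And>p. \<exists>\<rho>\<in>\<C>. \<rho> p \<noteq> 0 \<and> \<rho> * f \<in> \<C>"
  shows "f \<in> \<C>"
proof (intro smooth_functionsI smooth_on_local)
  fix U c x assume U: "(U, c) \<in> A" and "x \<in> c ` U"
  then obtain p where p: "p \<in> U" "x = c p" by auto
  obtain \<rho> where \<rho>: "\<rho> \<in> \<C>" "\<rho> p \<noteq> 0" "\<rho> * f \<in> \<C>" using assms by blast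
  let ?r = "\<rho> \<circ> inv_into U c" and ?h = "(\<rho> * f) \<circ> inv_into U c"
  note sr = smooth_functionsD[OF \<rho>(1) U] and sh = smooth_functionsD[OF \<rho>(3) U]
  define T where "T = c ` U \<inter> ?r -` (- {0})"
  have T: "open T"
    unfolding T_def
    by (rule continuous_open_preimage[OF smooth_on_imp_continuous_on[OF sr] chartD(2)[OF U]]) auto
  have "smooth_on T (\<lambda>y. ?h y * inverse (?r y))"
    by (intro smooth_on_mult smooth_on_inverse T smooth_on_subset[OF sr] smooth_on_subset[OF sh])
       (auto simp: T_def)
  then have "smooth_on T (f \<circ> inv_into U c)"
    by (rule smooth_on_cong[OF T, THEN iffD1, rotated]) (auto simp: T_def)
  moreover have "x \<in> T" using p \<rho>(2) chartD(4)[OF U] by (auto simp: T_def)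
  ultimately show "\<exists>T. open T \<and> x \<in> T \<and> smooth_on T (f \<circ> inv_into U c)" using T by blast
qed

section \<open>Tangent vectors, vector fields and the Lie bracket\<close>

lemma tangent_spaceD:
  assumes "v \<in> TS p"
  shows tangent_add: "f \<in> \<C> \<Longrightarrow> h \<in> \<C> \<Longrightarrow> v (f + h) = v f + v h"
    and tangent_scaleR: "f \<in> \<C> \<Longrightarrow> v (a *\<^sub>R f) = a * v f"
    and tangent_mult: "f \<in> \<C> \<Longrightarrow> h \<in> \<C> \<Longrightarrow> v (f * h) = f p * v h + h p * v f"
    and tangent_nonsmooth: "f \<notin> \<C> \<Longrightarrow> v f = 0"
  using assms by (auto simp: tangent_space_def)

lemma tangent_zero: "v \<in> TS p \<Longrightarrow> v 0 = 0"
  using tangent_scaleR[of v p 0 0] by simp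

lemma tangent_diff: "v \<in> TS p \<Longrightarrow> f \<in> \<C> \<Longrightarrow> h \<in> \<C> \<Longrightarrow> v (f - h) = v f - v h"
  using tangent_add[of v p f "(-1) *\<^sub>R h"] tangent_scaleR[of v p h "-1"] by simp

lemma tangent_sum:
  "v \<in> TS p \<Longrightarrow> (\<And>i. i \<in> I \<Longrightarrow> f i \<in> \<C>) \<Longrightarrow> v (\<Sum>i\<in>I. f i) = (\<Sum>i\<in>I. v (f i))"
  by (induction I rule: infinite_finite_induct) (auto simp: tangent_zero tangent_add sum_smooth)

lemma subspace_tangent_space: "subspace (TS p)"
  unfolding subspace_def by (auto simp: tangent_space_def algebra_simps)

lemmas tangent_space_closed [simp] =
  subspace_add[OF subspace_tangent_space] subspace_scale[OF subspace_tangent_space]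
  subspace_diff[OF subspace_tangent_space] subspace_0[OF subspace_tangent_space]
  subspace_neg[OF subspace_tangent_space]

lemma vector_fieldsD:
  assumes "X \<in> \<X>" shows "X p \<in> TS p" and [simp]: "f \<in> \<C> \<Longrightarrow> dir_deriv X f \<in> \<C>"
  using assms by (auto simp: vector_fields_def)

lemma dir_deriv_add_field: "dir_deriv (X + Y) f = dir_deriv X f + dir_deriv Y f"
  by (rule ext) (simp only: dir_deriv_def plus_fun_apply)

lemma dir_deriv_fun_scale: "dir_deriv (h *\<^sub>F X) f = h * dir_deriv X f"
  by (rule ext) (simp only: dir_deriv_def fun_scale_apply_apply times_fun_apply)

lemma dir_deriv_add:
  assumes "X \<in> \<X>" "f \<in> \<C>" "h \<in> \<C>"
  shows "dir_deriv X (f + h) = dir_deriv X f + dir_deriv X h"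
  by (rule ext)
    (simp only: dir_deriv_def plus_fun_apply tangent_add[OF vector_fieldsD(1)[OF assms(1)] assms(2,3)])

lemma dir_deriv_mult:
  assumes "X \<in> \<X>" "f \<in> \<C>" "h \<in> \<C>"
  shows "dir_deriv X (f * h) = f * dir_deriv X h + h * dir_deriv X f"
  by (rule ext) (simp only: dir_deriv_def plus_fun_apply times_fun_apply
      tangent_mult[OF vector_fieldsD(1)[OF assms(1)] assms(2,3)])

lemma vector_fieldsI:
  "(\<And>p. X p \<in> TS p) \<Longrightarrow> (\<And>f. f \<in> \<C> \<Longrightarrow> dir_deriv X f \<in> \<C>) \<Longrightarrow> X \<in> \<X>"
  unfolding vector_fields_def by blast

lemma vector_field_add [simp]:
  assumes "X \<in> \<X>" "Y \<in> \<X>" shows "X + Y \<in> \<X>"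
proof (rule vector_fieldsI)
  show "(X + Y) p \<in> TS p" for p
    using assms[THEN vector_fieldsD(1), of p] by simp
qed (simp add: dir_deriv_add_field assms)

lemma vector_field_fun_scale [simp]:
  assumes "f \<in> \<C>" "X \<in> \<X>" shows "f *\<^sub>F X \<in> \<X>"
proof (rule vector_fieldsI)
  show "(f *\<^sub>F X) p \<in> TS p" for p
    using vector_fieldsD(1)[OF assms(2), of p] by (simp add: fun_scale_apply)
qed (simp add: dir_deriv_fun_scale assms)

lemma vector_field_zero [simp]: "0 \<in> \<X>"
proof (rule vector_fieldsI)
  show "dir_deriv 0 f \<in> \<C>" for f
    by (simp add: dir_deriv_def)
qed simp

lemma vector_field_uminus [simp]: "X \<in> \<X> \<Longrightarrow> - X \<in> \<X>"
proof -
  assume "X \<in> \<X>"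
  then have "(\<lambda>_. - 1) *\<^sub>F X \<in> \<X>" by simp
  also have "(\<lambda>_. - 1) *\<^sub>F X = - X" by (simp add: fun_eq_iff)
  finally show ?thesis .
qed

lemma vector_field_diff [simp]: "X \<in> \<X> \<Longrightarrow> Y \<in> \<X> \<Longrightarrow> X - Y \<in> \<X>"
  using vector_field_add[of X "- Y"] by simp

lemma vector_field_sum: "(\<And>i. i \<in> I \<Longrightarrow> X i \<in> \<X>) \<Longrightarrow> (\<Sum>i\<in>I. X i) \<in> \<X>"
  by (induction I rule: infinite_finite_induct) auto

lemma field_nonsmooth: "X \<in> \<X> \<Longrightarrow> f \<notin> \<C> \<Longrightarrow> X p f = 0"
  using tangent_nonsmooth[OF vector_fieldsD(1)] .

lemma lie_bracket_field [simp]: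
  assumes X: "X \<in> \<X>" and Y: "Y \<in> \<X>"
  shows "lie_bracket X Y \<in> \<X>"
proof (rule vector_fieldsI)
  fix p
  have B: "lie_bracket X Y p f = X p (dir_deriv Y f) - Y p (dir_deriv X f)" for f
    by (simp add: lie_bracket_def)
  have D: "dir_deriv Z f p = Z p f" for Z :: "'a vfield" and f
    by (simp add: dir_deriv_def)
  note Xp = vector_fieldsD(1)[OF X, of p] and Yp = vector_fieldsD(1)[OF Y, of p]
    and dX = vector_fieldsD(2)[OF X] and dY = vector_fieldsD(2)[OF Y]
  show "lie_bracket X Y p \<in> TS p"
    unfolding tangent_space_def
  proof (intro CollectI conjI allI ballI impI)
    fix f h assume fh: "f \<in> \<C>" "h \<in> \<C>"
    show "lie_bracket X Y p (f + h) = lie_bracket X Y p f + lie_bracket X Y p h"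
      unfolding B dir_deriv_add[OF X fh] dir_deriv_add[OF Y fh]
        tangent_add[OF Xp dY dY, OF fh] tangent_add[OF Yp dX dX, OF fh] by simp
    \<comment> \<open>Applying the product rule twice produces the mixed terms X f * Y h and Y f * X
      h in both orders of differentiation, so they cancel in the difference.\<close>
    show "lie_bracket X Y p (f * h) = f p * lie_bracket X Y p h + h p * lie_bracket X Y p f"
      unfolding B dir_deriv_mult[OF X fh] dir_deriv_mult[OF Y fh]
      by (simp only: tangent_add[OF Xp] tangent_add[OF Yp] tangent_mult[OF Xp] tangent_mult[OF Yp]
          mult_smooth fh dX dY D) (simp add: algebra_simps)
  next
    fix a f assume f: "f \<in> \<C>"
    have "dir_deriv Z (a *\<^sub>R f) = a *\<^sub>R dir_deriv Z f" if "Z \<in> \<X>" for Z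
      using tangent_scaleR[OF vector_fieldsD(1)[OF that] f] by (simp add: dir_deriv_def fun_eq_iff)
    then show "lie_bracket X Y p (a *\<^sub>R f) = a * lie_bracket X Y p f"
      by (simp add: B X Y tangent_scaleR[OF Xp dY[OF f]] tangent_scaleR[OF Yp dX[OF f]] algebra_simps)
  next
    fix f assume "f \<notin> \<C>"
    then have "dir_deriv Z f = 0" if "Z \<in> \<X>" for Z
      using field_nonsmooth[OF that] by (simp add: dir_deriv_def fun_eq_iff)
    then show "lie_bracket X Y p f = 0"
      by (simp add: B X Y tangent_zero[OF Xp] tangent_zero[OF Yp])
  qed
next
  fix f assume "f \<in> \<C>"
  then have "dir_deriv X (dir_deriv Y f) - dir_deriv Y (dir_deriv X f) \<in> \<C>"
    using X Y by simp
  then show "dir_deriv (lie_bracket X Y) f \<in> \<C>"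
    by (simp add: dir_deriv_def lie_bracket_def fun_diff_def)
qed

text \<open>Off the smooth functions both fields are 0 by the normalisation of tangent
  vectors.\<close>

lemma vector_field_eqI:
  assumes "X \<in> \<X>" "Y \<in> \<X>" "\<And>f. f \<in> \<C> \<Longrightarrow> dir_deriv X f = dir_deriv Y f"
  shows "X = Y"
proof (intro ext)
  fix p f
  show "X p f = Y p f"
    using assms(3)[of f] field_nonsmooth[OF assms(1), of f p] field_nonsmooth[OF assms(2), of f p]
    by (cases "f \<in> \<C>") (simp_all add: dir_deriv_def fun_eq_iff)
qed

lemma dir_deriv_lie_bracket:
  "dir_deriv (lie_bracket X Y) f = dir_deriv X (dir_deriv Y f) - dir_deriv Y (dir_deriv X f)"
  by (simp add: dir_deriv_def lie_bracket_def fun_eq_iff)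

lemma lie_bracket_add:
  assumes "X \<in> \<X>" "Y \<in> \<X>" "Z \<in> \<X>"
  shows "lie_bracket X (Y + Z) = lie_bracket X Y + lie_bracket X Z"
  by (rule vector_field_eqI)
     (simp_all add: assms dir_deriv_lie_bracket dir_deriv_add_field dir_deriv_add)

lemma lie_bracket_fun_scale:
  assumes "X \<in> \<X>" "Y \<in> \<X>" "h \<in> \<C>"
  shows "lie_bracket X (h *\<^sub>F Y) = dir_deriv X h *\<^sub>F Y + h *\<^sub>F lie_bracket X Y"
  by (rule vector_field_eqI)
     (simp_all add: assms dir_deriv_lie_bracket dir_deriv_add_field dir_deriv_fun_scale
        dir_deriv_mult right_diff_distrib)

lemma lie_bracket_commute: "lie_bracket Y X = - lie_bracket X Y"
  by (simp add: lie_bracket_def fun_eq_iff)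

end

section \<open>Local frames by global vector fields\<close>

text \<open>Two radii are fixed so that the closed ball of radius \<open>r\<close>, outside which
  the bump vanishes, is a compact subset of the open ball of radius \<open>R\<close> on which local
  functions are given.\<close>

locale chart_ball = smooth_manifold A
  for A :: "('a::{t2_space, second_countable_topology}, 'e::euclidean_space) chart set" +
  fixes U :: "'a set" and c :: "'a \<Rightarrow> 'e" and a :: 'e and r R :: real
  assumes chart: "(U, c) \<in> A" and radii: "0 < r" "r < R" and ball_in: "ball a R \<subseteq> c ` U"
begin

definition extend :: "('e \<Rightarrow> real) \<Rightarrow> 'a \<Rightarrow> real" where
  "extend h m = (if m \<in> U \<and> c m \<in> ball a R then bump a r (c m) * h (c m) else 0)"

text \<open>The manifold is covered by the open set \<open>N\<close>, where the formula is a smooth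
  expression in the chart, and the complement of \<open>K\<close>, where the extension is 0.
  \<open>K\<close> is the image of a compact ball, hence closed because the manifold is Hausdorff,
  and it lies in \<open>N\<close>.\<close>

lemma extend_smooth:
  assumes h: "smooth_on (ball a R) h"
  shows "extend h \<in> \<C>"
proof (intro smooth_functionsI smooth_on_local)
  note inv = chartD(4)[OF chart]
  define N where "N = U \<inter> c -` ball a R"
  have N: "open N"
    unfolding N_def using chartD[OF chart]
    by (intro continuous_open_preimage) (auto dest: homeomorphism_cont1)
  fix V d x assume V: "(V, d) \<in> A" and "x \<in> d ` V"
  then obtain m where m: "m \<in> V" "x = d m" by auto
  note invd = chartD(4)[OF V]
  show "\<exists>T. open T \<and> x \<in> T \<and> smooth_on T (extend h \<circ> inv_into V d)"
  proof (cases "m \<in> N")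
    case True
    let ?T = "d ` (V \<inter> N)"
    have T: "open ?T" using chart_open_image[OF V] N chartD(1)[OF V] by auto
    have "smooth_on (ball a R) (\<lambda>y. bump a r y * h y)"
      by (intro smooth_on_mult smooth_on_bump h) auto
    moreover have "smooth_on ?T (c \<circ> inv_into V d)"
      by (rule smooth_on_subset[OF chartD(5)[OF V chart]]) (auto simp: N_def)
    moreover have "(c \<circ> inv_into V d) ` ?T \<subseteq> ball a R"
      using invd by (auto simp: N_def)
    ultimately have "smooth_on ?T ((\<lambda>y. bump a r y * h y) \<circ> (c \<circ> inv_into V d))"
      by (intro smooth_on_compose[OF T open_ball])
    then have "smooth_on ?T (extend h \<circ> inv_into V d)"
      by (rule smooth_on_cong[OF T, THEN iffD1, rotated]) (auto simp: invd N_def extend_def)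
    then show ?thesis using T True m by blast
  next
    case False
    define K where "K = inv_into U c ` cball a r"
    have sub: "cball a r \<subseteq> ball a R" using radii by (simp add: cball_subset_ball_iff)
    have "continuous_on (cball a r) (inv_into U c)"
      by (rule continuous_on_subset[OF homeomorphism_cont2[OF chartD(3)[OF chart]]])
         (use sub ball_in in blast)
    then have "compact K"
      unfolding K_def by (rule compact_continuous_image) (rule compact_cball)
    then have K: "closed K" by (rule compact_imp_closed)
    have "K \<subseteq> N"
    proof
      fix k assume "k \<in> K"
      then obtain y where y: "y \<in> cball a r" "k = inv_into U c y" by (auto simp: K_def)
      then have "y \<in> c ` U" using sub ball_in by blast
      then show "k \<in> N" using y sub by (auto simp: N_def inv)
    qed
    let ?T = "d ` (V - K)"
    have T: "open ?T" using chart_open_image[OF V] K chartD(1)[OF V] by (auto intro: open_Diff)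
    have "extend h q = 0" if "q \<notin> K" for q
    proof -
      have "c q \<notin> cball a r" if "q \<in> U"
        using inv[OF that] \<open>q \<notin> K\<close> unfolding K_def by (metis imageI)
      then show ?thesis using bump_eq_0_iff[OF radii(1), of a "c q"] ball_subset_cball[of a r]
        by (auto simp: extend_def)
    qed
    then have "(extend h \<circ> inv_into V d) y = 0" if "y \<in> ?T" for y
      using that invd by auto
    then have "smooth_on ?T (extend h \<circ> inv_into V d)"
      using smooth_on_cong[OF T, of "extend h \<circ> inv_into V d" "\<lambda>_. 0"] smooth_on_const[OF T] by blast
    then show ?thesis using T m False \<open>K \<subseteq> N\<close> by blast
  qed
qed

text \<open>Where \<open>cutoff\<close> is nonzero, the \<open>b\<close>-th coordinate is the
  quotient \<open>coord b / cutoff\<close> of global functions.\<close>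

definition cutoff :: "'a \<Rightarrow> real" where "cutoff = extend (\<lambda>_. 1)"
definition coord :: "'e \<Rightarrow> 'a \<Rightarrow> real" where "coord b = extend (\<lambda>y. y \<bullet> b)"
text \<open>The coordinate field in direction \<open>b\<close> multiplied by the bump function and
  extended by 0.\<close>

definition frame :: "'e \<Rightarrow> 'a vfield" where
  "frame b q f =
     (if f \<in> \<C> then extend (\<lambda>y. frechet_derivative (f \<circ> inv_into U c) (at y) b) q else 0)"

lemma apply_in:
  assumes "m \<in> U" "c m \<in> ball a R"
  shows "extend h m = bump a r (c m) * h (c m)"
    and "cutoff m = bump a r (c m)"
    and "coord b m = bump a r (c m) * (c m \<bullet> b)"
  using assms by (simp_all add: cutoff_def coord_def extend_def del: mem_ball)

lemma smooth_on_chart_ball: "f \<in> \<C> \<Longrightarrow> smooth_on (ball a R) (f \<circ> inv_into U c)"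
  using smooth_on_subset[OF smooth_functionsD[OF _ chart] ball_in] .

lemma cutoff_smooth [simp]: "cutoff \<in> \<C>"
  unfolding cutoff_def by (intro extend_smooth smooth_on_const) auto

lemma coord_smooth [simp]: "coord b \<in> \<C>"
  unfolding coord_def by (intro extend_smooth smooth_on_bounded_linear bounded_linear_inner_left) auto

lemma frame_field [simp]: "frame b \<in> \<X>"
proof (rule vector_fieldsI)
  note inv = chartD(4)[OF chart]
  fix p
  note der = smooth_on_frechet_derivative(2)[OF smooth_on_chart_ball]
  let ?D = "\<lambda>f. frechet_derivative (f \<circ> inv_into U c) (at (c p)) b"
  have add: "?D (f + h) = ?D f + ?D h" if "f \<in> \<C>" "h \<in> \<C>" "c p \<in> ball a R" for f h
  proof -
    have "(f + h) \<circ> inv_into U c = (\<lambda>x. (f \<circ> inv_into U c) x + (h \<circ> inv_into U c) x)"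
      by (rule ext) simp
    then show ?thesis
      by (simp only: frechet_derivative_at[OF has_derivative_add[OF der[OF that(1,3)] der[OF that(2,3)]], symmetric])
  qed
  have mult: "?D (f * h) = f p * ?D h + ?D f * h p"
    if "f \<in> \<C>" "h \<in> \<C>" "c p \<in> ball a R" "p \<in> U" for f h
  proof -
    have "(f * h) \<circ> inv_into U c = (\<lambda>x. (f \<circ> inv_into U c) x * (h \<circ> inv_into U c) x)"
      by (rule ext) simp
    then have "?D (f * h) = (f \<circ> inv_into U c) (c p) * ?D h + ?D f * (h \<circ> inv_into U c) (c p)"
      by (simp only: frechet_derivative_at[OF has_derivative_mult[OF der[OF that(1,3)] der[OF that(2,3)]], symmetric])
    then show ?thesis by (simp only: o_apply inv[OF that(4)])
  qed
  have scaleR: "?D (s *\<^sub>R f) = s * ?D f" if "f \<in> \<C>" "c p \<in> ball a R" for s f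
  proof -
    have "(s *\<^sub>R f) \<circ> inv_into U c = (\<lambda>x. s * (f \<circ> inv_into U c) x)"
      by (rule ext) simp
    then show ?thesis
      by (simp only: frechet_derivative_at[OF has_derivative_mult_right[OF der[OF that], of s], symmetric])
  qed
  show "frame b p \<in> TS p"
  proof (cases "p \<in> U \<and> c p \<in> ball a R")
    case False
    then have "frame b p f = 0" for f by (auto simp: frame_def extend_def)
    then have "frame b p = 0" by (intro ext) simp
    then show ?thesis by simp
  next
    case True
    then have p: "p \<in> U" "c p \<in> ball a R" by blast+
    have F: "frame b p f = bump a r (c p) * ?D f" if "f \<in> \<C>" for f
      using that p by (simp add: frame_def extend_def del: mem_ball)
    show ?thesis
      unfolding tangent_space_def
    proof (intro CollectI conjI allI ballI impI)
      fix f h assume fh: "f \<in> \<C>" "h \<in> \<C>"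
      show "frame b p (f + h) = frame b p f + frame b p h"
        by (simp only: F fh add_smooth add[OF fh p(2)] distrib_left)
      show "frame b p (f * h) = f p * frame b p h + h p * frame b p f"
        by (simp only: F fh mult_smooth mult[OF fh p(2,1)]) (simp add: algebra_simps)
    next
      fix s f assume f: "f \<in> \<C>"
      show "frame b p (s *\<^sub>R f) = s * frame b p f"
        by (simp only: F f scaleR_smooth scaleR[OF f p(2)]) simp
    next
      fix f assume "f \<notin> \<C>"
      then show "frame b p f = 0" by (simp add: frame_def)
    qed
  qed
next
  fix f assume f: "f \<in> \<C>"
  have "dir_deriv (frame b) f = extend (\<lambda>y. frechet_derivative (f \<circ> inv_into U c) (at y) b)"
    using f by (simp add: dir_deriv_def frame_def)
  then show "dir_deriv (frame b) f \<in> \<C>"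
    using extend_smooth smooth_on_frechet_derivative(1)[OF smooth_on_chart_ball[OF f]] by simp
qed

text \<open>\<open>coeff_of b q v\<close> is \<open>cutoff\<^sup>2\<close> times the \<open>b\<close>-th coordinate of \<open>v\<close>, written so that it involves
  only global smooth functions.\<close>

definition coeff_of :: "'e \<Rightarrow> 'a \<Rightarrow> 'a tvec \<Rightarrow> real" where
  "coeff_of b q v = cutoff q * v (coord b) - coord b q * v cutoff"

text \<open>Multiplying by \<open>cutoff ^ 3\<close> clears all denominators: the identity holds at every point of the
  manifold, also where the frame vanishes.\<close>

lemma tangent_frame_expansion:
  assumes v: "v \<in> TS q"
  shows "(cutoff q) ^ 3 *\<^sub>R v = (\<Sum>b\<in>Basis. coeff_of b q v *\<^sub>R frame b q)"
proof
  note inv = chartD(4)[OF chart]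
  fix f
  have "(cutoff q) ^ 3 * v f = (\<Sum>b\<in>Basis. coeff_of b q v * frame b q f)"
  proof (cases "f \<in> \<C> \<and> q \<in> U \<and> c q \<in> ball a R")
    case False
    then have "frame b q f = 0" for b
      by (auto simp: frame_def extend_def[of _ q])
    moreover have "cutoff q ^ 3 * v f = 0"
      using False tangent_nonsmooth[OF v, of f] by (auto simp: cutoff_def extend_def)
    ultimately show ?thesis by simp
  next
    case True
    then have f: "f \<in> \<C>" and q: "q \<in> U" "c q \<in> ball a R" by auto
    obtain h where h: "\<And>b. smooth_on (ball a R) (h b)"
      "\<And>b. h b (c q) = frechet_derivative (f \<circ> inv_into U c) (at (c q)) b"
      "\<And>x. x \<in> ball a R \<Longrightarrow> (f \<circ> inv_into U c) x =
         (f \<circ> inv_into U c) (c q) + (\<Sum>b\<in>Basis. ((x - c q) \<bullet> b) * h b x)"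
      by (rule hadamard[OF open_ball convex_ball q(2) smooth_on_chart_ball[OF f]], rule that)
    have eh [simp]: "extend (h b) \<in> \<C>" for b using extend_smooth[OF h(1)] .
    \<comment> \<open>Hadamard's formula at \<open>c q\<close> times the square of the bump: one
      factor globalises the coordinate differences, the other the coefficients \<open>h b\<close>.
      Only now is it an identity of global functions, to which \<open>v\<close> can be
      applied.\<close>
    have "cutoff * cutoff * f = f q *\<^sub>R (cutoff * cutoff) +
        (\<Sum>b\<in>Basis. (coord b - (c q \<bullet> b) *\<^sub>R cutoff) * extend (h b))"
    proof
      fix m
      show "(cutoff * cutoff * f) m = (f q *\<^sub>R (cutoff * cutoff) +
        (\<Sum>b\<in>Basis. (coord b - (c q \<bullet> b) *\<^sub>R cutoff) * extend (h b))) m"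
      proof (cases "m \<in> U \<and> c m \<in> ball a R")
        case False
        then have "cutoff m = 0" "extend (h b) m = 0" for b
          by (auto simp: cutoff_def extend_def)
        then show ?thesis by (simp add: sum_fun_apply)
      next
        case True
        then have "f m = f q + (\<Sum>b\<in>Basis. ((c m - c q) \<bullet> b) * h b (c m))"
          using h(3)[of "c m"] inv q by simp
        moreover have "bump a r (c m) * bump a r (c m) * (\<Sum>b\<in>Basis. ((c m - c q) \<bullet> b) * h b (c m)) =
          (\<Sum>b\<in>Basis. (coord b m - (c q \<bullet> b) * cutoff m) * extend (h b) m)"
          unfolding sum_distrib_left
          by (intro sum.cong refl)
             (simp only: apply_in[OF True[THEN conjunct1] True[THEN conjunct2]], simp add: algebra_simps)
        ultimately show ?thesis
          using True by (simp add: sum_fun_apply apply_in distrib_left del: mem_ball)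
      qed
    qed
    then have "v (cutoff * cutoff * f) = v (f q *\<^sub>R (cutoff * cutoff) +
        (\<Sum>b\<in>Basis. (coord b - (c q \<bullet> b) *\<^sub>R cutoff) * extend (h b)))"
      by (rule arg_cong)
    also have "\<dots> = f q * v (cutoff * cutoff) +
        (\<Sum>b\<in>Basis. v ((coord b - (c q \<bullet> b) *\<^sub>R cutoff) * extend (h b)))"
      by (simp add: tangent_add[OF v] tangent_scaleR[OF v] tangent_sum[OF v] sum_smooth)
    \<comment> \<open>The first factor of each product vanishes at \<open>q\<close>, so the Leibniz
      rule leaves only the term in which \<open>v\<close> falls on it.\<close>
    also have "(\<Sum>b\<in>Basis. v ((coord b - (c q \<bullet> b) *\<^sub>R cutoff) * extend (h b))) =
        (\<Sum>b\<in>Basis. cutoff q * h b (c q) * (v (coord b) - (c q \<bullet> b) * v cutoff))"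
      by (intro sum.cong refl)
        (simp add: tangent_mult[OF v] tangent_diff[OF v] tangent_scaleR[OF v] apply_in[OF q] del: mem_ball)
    finally have *: "v (cutoff * cutoff * f) = f q * v (cutoff * cutoff) +
        (\<Sum>b\<in>Basis. cutoff q * h b (c q) * (v (coord b) - (c q \<bullet> b) * v cutoff))" .
    \<comment> \<open>The Leibniz rule with the other grouping; the term
      \<open>f q * v (cutoff * cutoff)\<close> then cancels against the one in
      \<open>*\<close>.\<close>
    have "v (cutoff * cutoff * f) = cutoff q * cutoff q * v f + f q * v (cutoff * cutoff)"
      using tangent_mult[OF v mult_smooth[OF cutoff_smooth cutoff_smooth] f] by simp
    with * have "(cutoff q)\<^sup>2 * v f =
        (\<Sum>b\<in>Basis. cutoff q * h b (c q) * (v (coord b) - (c q \<bullet> b) * v cutoff))"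
      unfolding power2_eq_square by linarith
    \<comment> \<open>The third factor turns \<open>(c q \<bullet> b) * cutoff q\<close> into
      \<open>coord b q\<close>, which gives \<open>coeff_of\<close>; the factor
      \<open>cutoff q * h b (c q)\<close> is the frame field applied to \<open>f\<close>.\<close>
    then have "(cutoff q) ^ 3 * v f =
        cutoff q * (\<Sum>b\<in>Basis. cutoff q * h b (c q) * (v (coord b) - (c q \<bullet> b) * v cutoff))"
      by (simp add: power3_eq_cube power2_eq_square)
    also have "\<dots> = (\<Sum>b\<in>Basis. coeff_of b q v * frame b q f)"
      unfolding sum_distrib_left
      by (intro sum.cong refl)
        (simp add: coeff_of_def frame_def f h(2) apply_in[OF q] algebra_simps del: mem_ball)
    finally show ?thesis .
  qed
  then show "((cutoff q) ^ 3 *\<^sub>R v) f = (\<Sum>b\<in>Basis. coeff_of b q v *\<^sub>R frame b q) f"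
    by (simp add: sum_fun_apply)
qed

lemma field_frame_expansion:
  assumes X: "X \<in> \<X>"
  shows "(cutoff * cutoff * cutoff) *\<^sub>F X =
    (\<Sum>b\<in>Basis. (cutoff * dir_deriv X (coord b) - coord b * dir_deriv X cutoff) *\<^sub>F frame b)"
  using tangent_frame_expansion[OF vector_fieldsD(1)[OF X]]
  by (simp add: fun_eq_iff sum_fun_apply coeff_of_def dir_deriv_def power3_eq_cube)

text \<open>\<open>coeff_of\<close> is the numerator in the quotient rule for
  \<open>coord b / cutoff\<close>, so the derivatives of the bump cancel. Two factors
  \<open>cutoff\<close> are that denominator and the third is the scaling of the frame.\<close>

lemma coeff_of_frame:
  assumes p: "p \<in> U" "c p \<in> ball a R" and b: "b \<in> Basis" "b' \<in> Basis"
  shows "coeff_of b p (frame b' p) = (if b = b' then (cutoff p) ^ 3 else 0)"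
proof -
  let ?d = "\<lambda>f. frechet_derivative (f \<circ> inv_into U c) (at (c p))"
  have bump: "(bump a r has_derivative frechet_derivative (bump a r) (at (c p))) (at (c p))"
    using smooth_on_frechet_derivative(2)[OF smooth_on_bump[OF open_UNIV]] by simp
  have *: "?d (extend h) = (\<lambda>v. bump a r (c p) * h' v + frechet_derivative (bump a r) (at (c p)) v * h (c p))"
    if "(h has_derivative h') (at (c p))" for h h'
  proof -
    have "((extend h \<circ> inv_into U c) has_derivative
      (\<lambda>v. bump a r (c p) * h' v + frechet_derivative (bump a r) (at (c p)) v * h (c p))) (at (c p))"
    proof (rule has_derivative_transform_within_open[OF has_derivative_mult[OF bump that] open_ball p(2)])
      fix y assume "y \<in> ball a R"
      then show "bump a r y * h y = (extend h \<circ> inv_into U c) y"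
        using ball_in chartD(4)[OF chart] by (auto simp: extend_def)
    qed
    then show ?thesis by (rule frechet_derivative_at[symmetric])
  qed
  have 1: "?d cutoff b' = frechet_derivative (bump a r) (at (c p)) b'"
    unfolding cutoff_def using fun_cong[where x = b', OF *[OF has_derivative_const[where c = 1]]] by simp
  have 2: "?d (coord b) b' = bump a r (c p) * (b' \<bullet> b) + frechet_derivative (bump a r) (at (c p)) b' * (c p \<bullet> b)"
    unfolding coord_def
    by (rule fun_cong[where x = b', OF *[OF bounded_linear_imp_has_derivative[OF bounded_linear_inner_left]]])
  have "frame b' p (coord b) = bump a r (c p) * ?d (coord b) b'"
    and "frame b' p cutoff = bump a r (c p) * ?d cutoff b'"
    and "cutoff p = bump a r (c p)" and "coord b p = bump a r (c p) * (c p \<bullet> b)"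
    by (simp_all add: frame_def apply_in[OF p] del: mem_ball)
  then show ?thesis
    using b by (simp add: coeff_of_def 1 2 inner_Basis power3_eq_cube algebra_simps)
qed

text \<open>The linear functional \<open>coeff_of b p\<close> kills every other frame vector but not
  \<open>frame b p\<close>. Independence is stated for the indexed family, in the form in which
  Gram-Schmidt by induction on the index set consumes it.\<close>

lemma frame_independent:
  assumes p: "p \<in> U" "c p \<in> ball a r" and b: "b \<in> Basis"
  shows "frame b p \<notin> span ((\<lambda>b'. frame b' p) ` (Basis - {b}))"
proof
  have p': "c p \<in> ball a R" using p radii by auto
  have "subspace {v. coeff_of b p v = 0}"
    by (auto simp: subspace_def coeff_of_def algebra_simps)
  moreover have "(\<lambda>b'. frame b' p) ` (Basis - {b}) \<subseteq> {v. coeff_of b p v = 0}"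
    using coeff_of_frame[OF p(1) p' b] by auto
  ultimately have "span ((\<lambda>b'. frame b' p) ` (Basis - {b})) \<subseteq> {v. coeff_of b p v = 0}"
    by (rule span_minimal[rotated])
  moreover assume "frame b p \<in> span ((\<lambda>b'. frame b' p) ` (Basis - {b}))"
  ultimately have "cutoff p = 0"
    using coeff_of_frame[OF p(1) p' b b] by auto
  then show False
    using p p' bump_eq_0_iff[OF radii(1), of a "c p"] by (simp add: cutoff_def extend_def del: mem_ball)
qed

end

section \<open>Representation of linear forms\<close>

locale smooth_riemannian_manifold = smooth_manifold A
  for A :: "('a::{t2_space, second_countable_topology}, 'e::euclidean_space) chart set" +
  fixes g :: "'a \<Rightarrow> 'a tvec \<Rightarrow> 'a tvec \<Rightarrow> real"
  assumes metric: "riemannian_metric A g"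
begin

abbreviation G :: "'a vfield \<Rightarrow> 'a vfield \<Rightarrow> 'a \<Rightarrow> real" where
  "G X Y \<equiv> g \<odot> X \<odot> Y"

lemma
  assumes "u \<in> TS p" "v \<in> TS p"
  shows g_commute: "g p u v = g p v u"
    and g_add_right: "w \<in> TS p \<Longrightarrow> g p u (v + w) = g p u v + g p u w"
    and g_scaleR_right: "g p u (a *\<^sub>R v) = a * g p u v"
    and g_pos: "u \<noteq> 0 \<Longrightarrow> g p u u > 0"
  using metric assms unfolding riemannian_metric_def linear_on_subspace_def by auto

lemma g_smooth [simp]: "X \<in> \<X> \<Longrightarrow> Y \<in> \<X> \<Longrightarrow> G X Y \<in> \<C>"
  using metric unfolding riemannian_metric_def by blast

lemma g_apply: "G X Y p = g p (X p) (Y p)"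
  by (simp add: apply_field_def)

lemma g_add_left: "u \<in> TS p \<Longrightarrow> v \<in> TS p \<Longrightarrow> w \<in> TS p \<Longrightarrow> g p (u + v) w = g p u w + g p v w"
  using g_commute g_add_right tangent_space_closed(1) by metis

lemma g_scaleR_left: "u \<in> TS p \<Longrightarrow> v \<in> TS p \<Longrightarrow> g p (a *\<^sub>R u) v = a * g p u v"
  using g_commute g_scaleR_right tangent_space_closed(2) by metis

lemma g_diff_left: "u \<in> TS p \<Longrightarrow> v \<in> TS p \<Longrightarrow> w \<in> TS p \<Longrightarrow> g p (u - v) w = g p u w - g p v w"
  using g_add_left[of u p "(- 1) *\<^sub>R v" w] g_scaleR_left[of v p w "- 1"] by simp

lemma G_commute: "X \<in> \<X> \<Longrightarrow> Y \<in> \<X> \<Longrightarrow> G X Y = G Y X"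
  by (rule ext) (simp add: g_apply g_commute vector_fieldsD(1))

lemma G_add_left: "X \<in> \<X> \<Longrightarrow> Y \<in> \<X> \<Longrightarrow> Z \<in> \<X> \<Longrightarrow> G (X + Y) Z = G X Z + G Y Z"
  by (rule ext) (simp add: g_apply g_add_left vector_fieldsD(1))

lemma G_scale_left: "X \<in> \<X> \<Longrightarrow> Y \<in> \<X> \<Longrightarrow> G (f *\<^sub>F X) Y = f * G X Y"
  by (rule ext) (simp add: g_apply fun_scale_apply g_scaleR_left vector_fieldsD(1))

lemma G_add_right: "X \<in> \<X> \<Longrightarrow> Y \<in> \<X> \<Longrightarrow> Z \<in> \<X> \<Longrightarrow> G X (Y + Z) = G X Y + G X Z"
  by (rule ext) (simp add: g_apply g_add_right vector_fieldsD(1))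

lemma G_scale_right: "X \<in> \<X> \<Longrightarrow> Y \<in> \<X> \<Longrightarrow> G X (f *\<^sub>F Y) = f * G X Y"
  by (rule ext) (simp add: g_apply fun_scale_apply g_scaleR_right vector_fieldsD(1))

lemma G_uminus_left: "X \<in> \<X> \<Longrightarrow> Y \<in> \<X> \<Longrightarrow> G (- X) Y = - G X Y"
  by (rule ext) (use g_scaleR_left[OF vector_fieldsD(1) vector_fieldsD(1), of X Y _ "- 1"] in \<open>simp add: g_apply\<close>)

lemma G_diff_left: "X \<in> \<X> \<Longrightarrow> Y \<in> \<X> \<Longrightarrow> Z \<in> \<X> \<Longrightarrow> G (X - Y) Z = G X Z - G Y Z"
  by (rule ext) (simp add: g_apply g_diff_left vector_fieldsD(1))

lemma G_sum_right:
  assumes "X \<in> \<X>" "\<And>i. i \<in> I \<Longrightarrow> Y i \<in> \<X>"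
  shows "G X (\<Sum>i\<in>I. Y i) = (\<Sum>i\<in>I. G X (Y i))"
proof -
  have zero: "G X 0 = 0"
    using G_add_right[OF assms(1) vector_field_zero vector_field_zero] by simp
  show ?thesis
    using assms(2)
  proof (induction I rule: infinite_finite_induct)
    case (insert i I)
    then have IH: "G X (sum Y I) = (\<Sum>i\<in>I. G X (Y i))" and Y: "Y i \<in> \<X>" "sum Y I \<in> \<X>"
      by (auto intro: vector_field_sum)
    show ?case
      by (simp only: sum.insert[OF insert.hyps] G_add_right[OF assms(1) Y] IH)
  qed (simp_all only: sum.infinite sum.empty zero not_False_eq_True)
qed

lemma g_nondegenerate:
  assumes "X \<in> \<X>" "\<And>Z. Z \<in> \<X> \<Longrightarrow> G X Z p = 0"
  shows "X p = 0"
  using g_pos[OF vector_fieldsD(1)[OF assms(1)] vector_fieldsD(1)[OF assms(1)], of p]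
    assms(2)[OF assms(1)] by (auto simp: g_apply)

lemma field_eqI:
  assumes "X \<in> \<X>" "Y \<in> \<X>" "\<And>Z. Z \<in> \<X> \<Longrightarrow> G X Z = G Y Z"
  shows "X = Y"
proof
  fix p
  have "(X - Y) p = 0"
    by (rule g_nondegenerate[of "X - Y"]) (simp_all add: assms G_diff_left)
  then show "X p = Y p" by simp
qed

text \<open>Gram-Schmidt, cleared of denominators so that all fields stay global.\<close>

lemma prescribed_pairings:
  assumes "finite I" "\<And>i. i \<in> I \<Longrightarrow> E i \<in> \<X>"
    and "\<And>i. i \<in> I \<Longrightarrow> E i p \<notin> span ((\<lambda>j. E j p) ` (I - {i}))"
    and "\<And>i. i \<in> I \<Longrightarrow> \<omega> i \<in> \<C>"
  shows "\<exists>\<rho>\<in>\<C>. \<exists>W\<in>\<X>. \<rho> p \<noteq> 0 \<and> W p \<in> span ((\<lambda>i. E i p) ` I) \<and> (\<forall>i\<in>I. G W (E i) = \<rho> * \<omega> i)"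
  using assms
proof (induction I arbitrary: \<omega> rule: finite_induct)
  case empty
  show ?case by (rule bexI[of _ 1], rule bexI[of _ 0]) auto
next
  case (insert k I)
  let ?S = "span ((\<lambda>i. E i p) ` I)"
  have E: "E k \<in> \<X>" "\<And>i. i \<in> I \<Longrightarrow> E i \<in> \<X>" and \<omega>: "\<omega> k \<in> \<C>" "\<And>i. i \<in> I \<Longrightarrow> \<omega> i \<in> \<C>"
    using insert.prems by auto
  have indep: "E i p \<notin> span ((\<lambda>j. E j p) ` (I - {i}))" if "i \<in> I" for i
    using insert.prems(2)[of i] that span_mono[of "(\<lambda>j. E j p) ` (I - {i})" "(\<lambda>j. E j p) ` (insert k I - {i})"]
    by blast
  have k: "E k p \<notin> ?S"
    using insert.prems(2)[of k] insert.hyps by simp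
  note IH = insert.IH[OF E(2) indep]
  \<comment> \<open>At \<open>p\<close>, \<open>V\<close> is \<open>\<sigma> p\<close> times the
    orthogonal projection of \<open>E k\<close> to the span of the other vectors; the pairings
    themselves are prescribed on the whole manifold.\<close>
  obtain \<sigma> V where V: "\<sigma> \<in> \<C>" "V \<in> \<X>" "\<sigma> p \<noteq> 0" "V p \<in> ?S" "\<And>i. i \<in> I \<Longrightarrow> G V (E i) = \<sigma> * G (E k) (E i)"
    using IH[of "\<lambda>i. G (E k) (E i)"] E by (metis g_smooth)
  \<comment> \<open>Orthogonal to the fields indexed by \<open>I\<close> everywhere, and nonzero at
    \<open>p\<close> because \<open>V p\<close> lies in their span there while \<open>E k p\<close>
    does not.\<close>
  define u where "u = \<sigma> *\<^sub>F E k - V"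
  have u: "u \<in> \<X>" using V E by (simp add: u_def)
  have uE: "G u (E i) = 0" if "i \<in> I" for i
    using V E that by (simp add: u_def G_diff_left G_scale_left)
  note up = vector_fieldsD(1)[OF u, of p] and Vp = vector_fieldsD(1)[OF V(2), of p]
    and Ep = vector_fieldsD(1)[OF E(1), of p]
  have "subspace {v \<in> TS p. g p (u p) v = 0}"
    using up g_scaleR_right[OF up subspace_0[OF subspace_tangent_space], of 0]
    by (auto simp: subspace_def g_add_right g_scaleR_right)
  moreover have "(\<lambda>i. E i p) ` I \<subseteq> {v \<in> TS p. g p (u p) v = 0}"
    using vector_fieldsD(1)[OF E(2), of _ p] uE[THEN fun_cong, of _ p] by (auto simp: g_apply)
  ultimately have perp: "?S \<subseteq> {v \<in> TS p. g p (u p) v = 0}"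
    by (rule span_minimal[rotated])
  have "u p \<noteq> 0"
  proof
    assume "u p = 0"
    then have "\<sigma> p *\<^sub>R E k p = V p" by (simp add: u_def fun_scale_apply)
    then have "E k p = (1 / \<sigma> p) *\<^sub>R V p" using V(3) by (metis (no_types) divide_self_if scaleR_one scaleR_scaleR times_divide_eq_left mult_1)
    then show False using k V(4) span_scale by metis
  qed
  then have "0 < g p (u p) (u p)" using g_pos up by blast
  \<comment> \<open>\<open>V p\<close> is in the span to which \<open>u p\<close> is orthogonal and
    drops out of the pairing. This is why membership in the span is carried through the
    induction.\<close>
  also have "g p (u p) (u p) = \<sigma> p * g p (u p) (E k p)"
  proof -
    have *: "\<sigma> p *\<^sub>R E k p = u p + V p" by (simp add: u_def fun_scale_apply)
    have "\<sigma> p * g p (u p) (E k p) = g p (u p) (u p + V p)"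
      using g_scaleR_right[OF up Ep, of "\<sigma> p"] by (simp only: *)
    also have "\<dots> = g p (u p) (u p) + g p (u p) (V p)" using g_add_right[OF up up Vp] .
    finally show ?thesis using perp V(4) by auto
  qed
  finally have ne: "G u (E k) p \<noteq> 0" by (auto simp: g_apply)
  obtain \<rho> W where W: "\<rho> \<in> \<C>" "W \<in> \<X>" "\<rho> p \<noteq> 0" "W p \<in> ?S" "\<And>i. i \<in> I \<Longrightarrow> G W (E i) = \<rho> * \<omega> i"
    using IH[of \<omega>] \<omega> by metis
  \<comment> \<open>Adding a multiple of \<open>u\<close> leaves the pairings with the fields
    indexed by \<open>I\<close> alone. Its coefficient is chosen so that the pairing with
    \<open>E k\<close> acquires the same overall factor \<open>G u (E k) * \<rho>\<close>, nonzero
    at \<open>p\<close>.\<close>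
  define W' where "W' = G u (E k) *\<^sub>F W + (\<rho> * \<omega> k - G W (E k)) *\<^sub>F u"
  have S: "?S \<subseteq> span ((\<lambda>i. E i p) ` insert k I)" by (rule span_mono) auto
  have u_p: "u p = \<sigma> p *\<^sub>R E k p - V p" by (simp add: u_def fun_scale_apply)
  have W'_p: "W' p = G u (E k) p *\<^sub>R W p + (\<rho> * \<omega> k - G W (E k)) p *\<^sub>R u p"
    unfolding W'_def by (simp add: fun_scale_apply)
  have "u p \<in> span ((\<lambda>i. E i p) ` insert k I)"
    unfolding u_p
    by (intro span_diff span_scale span_base imageI insertI1 subsetD[OF S V(4)])
  then have "W' p \<in> span ((\<lambda>i. E i p) ` insert k I)"
    unfolding W'_p
    by (intro span_add span_scale subsetD[OF S W(4)])
  moreover have "G u (E k) * \<rho> \<in> \<C>" "W' \<in> \<X>" "(G u (E k) * \<rho>) p \<noteq> 0"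
    using u W E V \<omega> ne by (simp_all add: W'_def)
  moreover have "G W' (E i) = G u (E k) * \<rho> * \<omega> i" if "i \<in> insert k I" for i
  proof -
    have Ei: "E i \<in> \<X>" using that E by auto
    have "G W' (E i) = G u (E k) * G W (E i) + (\<rho> * \<omega> k - G W (E k)) * G u (E i)"
      unfolding W'_def using u W E V \<omega> Ei by (simp add: G_add_left G_scale_left)
    then show ?thesis
      using that W(5) uE by (cases "i = k") (simp_all add: algebra_simps)
  qed
  ultimately show ?case by blast
qed

lemma linear_form_sum:
  assumes add: "\<And>X Y. X \<in> \<X> \<Longrightarrow> Y \<in> \<X> \<Longrightarrow> \<omega> (X + Y) = \<omega> X + (\<omega> Y :: 'a \<Rightarrow> real)"
    and scale: "\<And>f X. f \<in> \<C> \<Longrightarrow> X \<in> \<X> \<Longrightarrow> \<omega> (f *\<^sub>F X) = f * \<omega> X"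
    and X: "\<And>i. i \<in> I \<Longrightarrow> X i \<in> \<X>"
  shows "\<omega> (\<Sum>i\<in>I. X i) = (\<Sum>i\<in>I. \<omega> (X i))"
proof -
  have zero: "\<omega> 0 = 0"
    using add[OF vector_field_zero vector_field_zero] by simp
  show ?thesis using X
  proof (induction I rule: infinite_finite_induct)
    case (insert i I)
    then have IH: "\<omega> (sum X I) = (\<Sum>i\<in>I. \<omega> (X i))" and Xi: "X i \<in> \<X>" "sum X I \<in> \<X>"
      by (auto intro: vector_field_sum)
    show ?case
      by (simp only: sum.insert[OF insert.hyps] add[OF Xi] IH)
  qed (simp_all only: sum.infinite sum.empty zero not_False_eq_True)
qed

text \<open>The frame spans a field \<open>X\<close> only after scaling by \<open>\<kappa>\<close>,
  the cube of \<open>cutoff\<close>. The field \<open>W\<close> matching \<open>\<omega>\<close> on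
  the frame is therefore scaled as well; linearity over smooth functions moves
  \<open>\<kappa>\<close> from \<open>W\<close> to \<open>X\<close> in the pairing, and finally out
  of \<open>\<omega>\<close>.\<close>

lemma local_representation:
  assumes smooth: "\<And>X. X \<in> \<X> \<Longrightarrow> \<omega> X \<in> \<C>"
    and add: "\<And>X Y. X \<in> \<X> \<Longrightarrow> Y \<in> \<X> \<Longrightarrow> \<omega> (X + Y) = \<omega> X + \<omega> Y"
    and scale: "\<And>f X. f \<in> \<C> \<Longrightarrow> X \<in> \<X> \<Longrightarrow> \<omega> (f *\<^sub>F X) = f * \<omega> X"
  shows "\<exists>\<rho>\<in>\<C>. \<exists>W\<in>\<X>. \<rho> p \<noteq> 0 \<and> (\<forall>X\<in>\<X>. G W X = \<rho> * \<omega> X)"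
proof -
  obtain U c where U: "(U, c) \<in> A" and p: "p \<in> U" by (rule chart_exists)
  have "open (c ` U)" "c p \<in> c ` U" using chartD(2)[OF U] p by auto
  then obtain R where R: "R > 0" "ball (c p) R \<subseteq> c ` U" by (meson open_contains_ball)
  interpret chart_ball A U c "c p" "R / 2" R
    by unfold_locales (use U R in auto)
  have pr: "c p \<in> ball (c p) (R / 2)" and pR: "c p \<in> ball (c p) R" using R(1) by auto
  obtain \<rho> W where W: "\<rho> \<in> \<C>" "W \<in> \<X>" "\<rho> p \<noteq> 0"
    "\<And>b. b \<in> Basis \<Longrightarrow> G W (frame b) = \<rho> * \<omega> (frame b)"
    using prescribed_pairings[where I = Basis and E = frame and \<omega> = "\<lambda>b. \<omega> (frame b)",
        OF finite_Basis frame_field frame_independent[OF p pr] smooth[OF frame_field]]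
    by blast
  define \<kappa> where "\<kappa> = cutoff * cutoff * cutoff"
  have \<kappa>: "\<kappa> \<in> \<C>" by (simp add: \<kappa>_def)
  have "cutoff p \<noteq> 0"
    using bump_eq_0_iff[OF radii(1), of "c p" "c p"] pr apply_in(2)[OF p pR] by simp
  then have "(\<kappa> * \<rho>) p \<noteq> 0" using W(3) by (simp add: \<kappa>_def)
  moreover have "G (\<kappa> *\<^sub>F W) X = \<kappa> * \<rho> * \<omega> X" if X: "X \<in> \<X>" for X
  proof -
    define a where "a = (\<lambda>b. cutoff * dir_deriv X (coord b) - coord b * dir_deriv X cutoff)"
    have a: "a b \<in> \<C>" for b unfolding a_def by (simp add: X)
    have ex: "\<kappa> *\<^sub>F X = (\<Sum>b\<in>Basis. a b *\<^sub>F frame b)"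
      unfolding \<kappa>_def a_def by (rule field_frame_expansion[OF X])
    have "G (\<kappa> *\<^sub>F W) X = G W (\<kappa> *\<^sub>F X)"
      using X W(2) by (simp only: G_scale_left G_scale_right)
    also have "\<dots> = (\<Sum>b\<in>Basis. a b * G W (frame b))"
      unfolding ex using W(2) a
      by (simp only: G_sum_right G_scale_right frame_field vector_field_fun_scale)
    also have "\<dots> = \<rho> * (\<Sum>b\<in>Basis. a b * \<omega> (frame b))"
      unfolding sum_distrib_left by (intro sum.cong refl) (simp only: W(4) mult.left_commute)
    also have "(\<Sum>b\<in>Basis. a b * \<omega> (frame b)) = \<omega> (\<kappa> *\<^sub>F X)"
      unfolding ex using a
      by (simp only: linear_form_sum[of \<omega>, OF add scale] scale frame_field vector_field_fun_scale)
    also have "\<rho> * \<omega> (\<kappa> *\<^sub>F X) = \<kappa> * \<rho> * \<omega> X"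
      by (simp only: scale[OF \<kappa> X] mult_ac)
    finally show ?thesis .
  qed
  ultimately show ?thesis
    using mult_smooth[OF \<kappa> W(1)] vector_field_fun_scale[OF \<kappa> W(2)] by blast
qed

lemma representation:
  assumes smooth: "\<And>X. X \<in> \<X> \<Longrightarrow> \<omega> X \<in> \<C>"
    and add: "\<And>X Y. X \<in> \<X> \<Longrightarrow> Y \<in> \<X> \<Longrightarrow> \<omega> (X + Y) = \<omega> X + \<omega> Y"
    and scale: "\<And>f X. f \<in> \<C> \<Longrightarrow> X \<in> \<X> \<Longrightarrow> \<omega> (f *\<^sub>F X) = f * \<omega> X"
  shows "\<exists>w\<in>\<X>. \<forall>X\<in>\<X>. G w X = \<omega> X"
proof -
  have "\<forall>p. \<exists>\<rho> W. \<rho> \<in> \<C> \<and> W \<in> \<X> \<and> \<rho> p \<noteq> 0 \<and> (\<forall>X\<in>\<X>. G W X = \<rho> * \<omega> X)"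
    using local_representation[of \<omega>, OF smooth add scale] by blast
  then obtain \<rho> W where "\<forall>p. \<rho> p \<in> \<C> \<and> W p \<in> \<X> \<and> \<rho> p p \<noteq> 0 \<and> (\<forall>X\<in>\<X>. G (W p) X = \<rho> p * \<omega> X)"
    unfolding choice_iff by blast
  then have \<rho>: "\<And>p. \<rho> p \<in> \<C>" "\<And>p. \<rho> p p \<noteq> 0" and W: "\<And>p. W p \<in> \<X>"
    and GW: "\<And>p X. X \<in> \<X> \<Longrightarrow> G (W p) X = \<rho> p * \<omega> X"
    by blast+
  \<comment> \<open>Each factor is known to be nonzero only at the point for which it was chosen,
    hence the diagonal values.\<close>
  define w where "w = (\<lambda>q. (1 / \<rho> q q) *\<^sub>R W q q)"
  have wT: "w q \<in> TS q" for q
    unfolding w_def using vector_fieldsD(1)[OF W] by simp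
  have gw: "g q (w q) (X q) = \<omega> X q" if X: "X \<in> \<X>" for X q
  proof -
    have "g q (W q q) (X q) = \<rho> q q * \<omega> X q"
      using GW[OF X, of q, THEN fun_cong, of q] by (simp add: g_apply)
    then show ?thesis
      unfolding w_def g_scaleR_left[OF vector_fieldsD(1)[OF W] vector_fieldsD(1)[OF X]]
      using \<rho>(2)[of q] by simp
  qed
  have scaled: "\<rho> p q *\<^sub>R w q = W p q" for p q
  proof -
    \<comment> \<open>The comparison concerns the single point \<open>q\<close>, so the ratio may be
      frozen to a constant; this makes \<open>Z\<close> a global vector field, as
      \<open>g_nondegenerate\<close> requires.\<close>
    define Z where "Z = (\<lambda>_. \<rho> p q / \<rho> q q) *\<^sub>F W q - W p"
    have Z: "Z \<in> \<X>" unfolding Z_def using W by simp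
    have Zq: "Z q = \<rho> p q *\<^sub>R w q - W p q"
      by (simp add: Z_def fun_scale_apply w_def)
    have "Z q = 0"
    proof (rule g_nondegenerate[OF Z])
      fix X assume X: "X \<in> \<X>"
      note XT = vector_fieldsD(1)[OF X, of q] and WT = vector_fieldsD(1)[OF W, of p q]
      have "G Z X q = \<rho> p q * g q (w q) (X q) - g q (W p q) (X q)"
        by (simp only: g_apply Zq g_diff_left[OF tangent_space_closed(2)[OF wT] WT XT] g_scaleR_left[OF wT XT])
      also have "g q (W p q) (X q) = \<rho> p q * \<omega> X q"
        using GW[OF X, of p, THEN fun_cong, of q] by (simp add: g_apply)
      finally show "G Z X q = 0" using gw[OF X] by simp
    qed
    then show ?thesis using Zq by simp
  qed
  have "w \<in> \<X>"
  proof (rule vector_fieldsI[OF wT])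
    fix f assume f: "f \<in> \<C>"
    have "\<rho> p * dir_deriv w f = dir_deriv (W p) f" for p
    proof
      fix q show "(\<rho> p * dir_deriv w f) q = dir_deriv (W p) f q"
        using scaled[of p q, THEN fun_cong, of f] by (simp add: dir_deriv_def)
    qed
    then have "\<rho> p * dir_deriv w f \<in> \<C>" for p
      using vector_fieldsD(2)[OF W f] by simp
    then show "dir_deriv w f \<in> \<C>"
      using \<rho> by (intro locally_quotient_smooth) blast
  qed
  moreover have "G w X = \<omega> X" if "X \<in> \<X>" for X
    by (rule ext) (simp only: g_apply gw[OF that])
  ultimately show ?thesis by blast
qed

end

section \<open>The Koszul formula\<close>

locale leibniz_bracket = smooth_riemannian_manifold A g
  for A :: "('a::{t2_space, second_countable_topology}, 'e::euclidean_space) chart set"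
    and g :: "'a \<Rightarrow> 'a tvec \<Rightarrow> 'a tvec \<Rightarrow> real" +
  fixes B :: "'a vfield \<Rightarrow> 'a vfield \<Rightarrow> 'a vfield"
  assumes B_field: "x \<in> vector_fields A \<Longrightarrow> y \<in> vector_fields A \<Longrightarrow> B x y \<in> vector_fields A"
    and B_skew: "x \<in> vector_fields A \<Longrightarrow> y \<in> vector_fields A \<Longrightarrow> B y x = - B x y"
    and B_add_right: "x \<in> vector_fields A \<Longrightarrow> y \<in> vector_fields A \<Longrightarrow> z \<in> vector_fields A \<Longrightarrow>
      B x (y + z) = B x y + B x z"
    and B_scale_right: "x \<in> vector_fields A \<Longrightarrow> y \<in> vector_fields A \<Longrightarrow> f \<in> smooth_functions A \<Longrightarrow>
      B x (f *\<^sub>F y) = dir_deriv x f *\<^sub>F y + f *\<^sub>F B x y"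
begin

lemma B_add_left:
  assumes "x \<in> \<X>" "y \<in> \<X>" "z \<in> \<X>"
  shows "B (x + y) z = B x z + B y z"
  by (simp only: B_skew[OF assms(3) vector_field_add[OF assms(1,2)]] B_add_right[OF assms(3,1,2)]
      B_skew[OF assms(3,1)] B_skew[OF assms(3,2)] minus_add_distrib)

lemma B_scale_left:
  assumes "x \<in> \<X>" "y \<in> \<X>" "f \<in> \<C>"
  shows "B (f *\<^sub>F x) y = f *\<^sub>F B x y - dir_deriv y f *\<^sub>F x"
proof -
  have "B (f *\<^sub>F x) y = - (dir_deriv y f *\<^sub>F x + f *\<^sub>F (- B x y))"
    by (simp only: B_skew[OF assms(2) vector_field_fun_scale[OF assms(3,1)]] B_scale_right[OF assms(2,1,3)]
        B_skew[OF assms(1,2)])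
  also have "\<dots> = f *\<^sub>F B x y - dir_deriv y f *\<^sub>F x"
    by (intro ext) simp
  finally show ?thesis .
qed

text \<open>The right side of the classical Koszul formula with \<open>B\<close> in place of the Lie
  bracket.\<close>

definition K :: "'a vfield \<Rightarrow> 'a vfield \<Rightarrow> 'a vfield \<Rightarrow> 'a \<Rightarrow> real" where
  "K x y z = dir_deriv x (G y z) + dir_deriv y (G x z) - dir_deriv z (G x y)
     + G (B x y) z - G (B y z) x + G (B z x) y"

lemmas calculus = dir_deriv_add dir_deriv_mult dir_deriv_add_field dir_deriv_fun_scale
  G_add_left G_scale_left G_add_right G_scale_right G_uminus_left G_diff_left
  B_add_left B_add_right B_scale_left B_scale_right
  B_field vector_field_add vector_field_fun_scale vector_field_uminus vector_fieldsD(2)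
  g_smooth mult_smooth

lemma K_smooth:
  assumes "x \<in> \<X>" "y \<in> \<X>" "z \<in> \<X>" shows "K x y z \<in> \<C>"
  unfolding K_def by (simp only: assms calculus add_smooth diff_smooth)

context
  fixes x y z w f
  assumes x: "x \<in> \<X>" and y: "y \<in> \<X>" and z: "z \<in> \<X>" and w: "w \<in> \<X>" and f: "f \<in> \<C>"
begin

lemma K_add1: "K (x + w) y z = K x y z + K w y z"
  unfolding K_def by (simp only: x y z w calculus, rule ext, simp)

lemma K_add2: "K x (y + w) z = K x y z + K x w z"
  unfolding K_def by (simp only: x y z w calculus, rule ext, simp)

lemma K_add3: "K x y (z + w) = K x y z + K x y w"
  unfolding K_def by (simp only: x y z w calculus, rule ext, simp)

text \<open>The derivatives of \<open>f\<close> along \<open>y\<close> and \<open>z\<close> arise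
  once from a metric term and once, with opposite sign, from the Leibniz rule of \<open>B\<close>.
  The same cancellation gives \<open>K_scale3\<close>.\<close>

lemma K_scale1: "K (f *\<^sub>F x) y z = f * K x y z"
  unfolding K_def
  by (simp only: x y z f calculus G_commute[OF y x] G_commute[OF z x] G_commute[OF z y],
      rule ext, simp add: algebra_simps)

text \<open>The derivatives along \<open>z\<close> cancel, but those along \<open>x\<close> from the
  metric term and from \<open>B x (f *\<^sub>F y)\<close> have equal signs. After halving, their sum
  is the derivative term in the Leibniz rule of a connection.\<close>

lemma K_scale2: "K x (f *\<^sub>F y) z = f * K x y z + 2 * dir_deriv x f * G y z"
  unfolding K_def
  by (simp only: x y z f calculus G_commute[OF y x] G_commute[OF z x] G_commute[OF z y],
      rule ext, simp add: algebra_simps)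

lemma K_scale3: "K x y (f *\<^sub>F z) = f * K x y z"
  unfolding K_def
  by (simp only: x y z f calculus G_commute[OF y x] G_commute[OF z x] G_commute[OF z y],
      rule ext, simp add: algebra_simps)

text \<open>This and \<open>K_metric\<close> are twice the torsion condition and twice metric
  compatibility for the connection that pairs to half of \<open>K\<close>: swapping two arguments
  makes all other terms cancel.\<close>

lemma K_skew: "K x y z p - K y x z p = 2 * G (B x y) z p"
  unfolding K_def
  by (simp only: x y z calculus G_commute[OF y x] B_skew[OF x y] B_skew[OF z x] B_skew[OF y z]) simp

lemma K_metric: "K x y z p + K x z y p = 2 * dir_deriv x (G y z) p"
  unfolding K_def
  by (simp only: x y z calculus G_commute[OF z y] B_skew[OF y x] B_skew[OF z x] B_skew[OF z y]) simp

end

text \<open>Metric compatibility and the torsion condition write \<open>K\<close> as a sum of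
  pairings with values of \<open>D\<close>; all of them cancel except \<open>G (D x y) z\<close>,
  which occurs twice.\<close>

lemma koszul_formula:
  assumes D: "\<And>x y. x \<in> \<X> \<Longrightarrow> y \<in> \<X> \<Longrightarrow> D x y \<in> \<X>"
    and torsion: "\<And>x y. x \<in> \<X> \<Longrightarrow> y \<in> \<X> \<Longrightarrow> D x y - D y x = B x y"
    and met: "\<And>x y z. x \<in> \<X> \<Longrightarrow> y \<in> \<X> \<Longrightarrow> z \<in> \<X> \<Longrightarrow> cov_deriv_metric D g x y z = 0"
    and x: "x \<in> \<X>" and y: "y \<in> \<X>" and z: "z \<in> \<X>"
  shows "G (D x y) z = (\<lambda>_. 1 / 2) * K x y z"
proof
  fix p
  have m: "dir_deriv u (G v w) p = G (D u v) w p + G (D u w) v p"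
    if "u \<in> \<X>" "v \<in> \<X>" "w \<in> \<X>" for u v w
  proof -
    have "cov_deriv_metric D g u v w p = 0" by (simp only: met[OF that] zero_fun_apply)
    then show ?thesis
      by (simp add: cov_deriv_metric_def G_commute[OF that(2) D[OF that(1,3)]])
  qed
  have t: "G (B u v) w p = G (D u v) w p - G (D v u) w p"
    if "u \<in> \<X>" "v \<in> \<X>" "w \<in> \<X>" for u v w
    using torsion[OF that(1,2), symmetric] by (simp add: G_diff_left D that)
  show "G (D x y) z p = ((\<lambda>_. 1 / 2) * K x y z) p"
    by (simp add: K_def m[OF x y z] m[OF y x z] m[OF z x y] t[OF x y z] t[OF y z x] t[OF z x y])
qed

lemma metric_connection_with_bracket:
  "\<exists>!D. linear_connection A D \<and> (\<forall>x\<in>\<X>. \<forall>y\<in>\<X>. D x y - D y x = B x y) \<and>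
     (\<forall>x\<in>\<X>. \<forall>y\<in>\<X>. \<forall>z\<in>\<X>. cov_deriv_metric D g x y z = 0)"
proof (rule ex_ex1I)
  let ?h = "\<lambda>_::'a. 1 / 2 :: real"
  have h: "?h \<in> \<C>" by (rule const_smooth)
  have "\<exists>w. w \<in> \<X> \<and> (\<forall>z\<in>\<X>. G w z = ?h * K x y z)" if x: "x \<in> \<X>" and y: "y \<in> \<X>" for x y
  proof -
    have "\<exists>w\<in>\<X>. \<forall>z\<in>\<X>. G w z = ?h * K x y z"
    proof (rule representation)
      fix z assume z: "z \<in> \<X>"
      show "?h * K x y z \<in> \<C>" using mult_smooth[OF h K_smooth[OF x y z]] .
      fix w assume w: "w \<in> \<X>"
      show "?h * K x y (z + w) = ?h * K x y z + ?h * K x y w"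
        by (simp only: K_add3[OF x y z w h] distrib_left)
    next
      fix f z assume f: "f \<in> \<C>" and z: "z \<in> \<X>"
      show "?h * K x y (f *\<^sub>F z) = f * (?h * K x y z)"
        by (simp only: K_scale3[OF x y z z f] mult.left_commute)
    qed
    then show ?thesis by blast
  qed
  then have "\<forall>x y. \<exists>w. x \<in> \<X> \<longrightarrow> y \<in> \<X> \<longrightarrow> w \<in> \<X> \<and> (\<forall>z\<in>\<X>. G w z = ?h * K x y z)"
    by blast
  then obtain D0 where D0: "\<And>x y. x \<in> \<X> \<Longrightarrow> y \<in> \<X> \<Longrightarrow> D0 x y \<in> \<X> \<and> (\<forall>z\<in>\<X>. G (D0 x y) z = ?h * K x y z)"
    unfolding choice_iff by blast
  \<comment> \<open>The value 0 off the vector fields is the normalisation demanded by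
    \<open>linear_connection\<close>.\<close>
  define D where "D = (\<lambda>x y. if x \<in> \<X> \<and> y \<in> \<X> then D0 x y else 0)"
  have D: "D x y \<in> \<X>" and GD: "\<And>z. z \<in> \<X> \<Longrightarrow> G (D x y) z = ?h * K x y z"
    if "x \<in> \<X>" "y \<in> \<X>" for x y
    using D0[OF that] that by (simp_all add: D_def)
  \<comment> \<open>On vector fields, each axiom is paired with an arbitrary field through
    \<open>field_eqI\<close>, which turns it into one of the rules for \<open>K\<close>.\<close>
  have "linear_connection A D"
    unfolding linear_connection_def
  proof (intro conjI ballI allI impI)
    fix x y assume x: "x \<in> \<X>" and y: "y \<in> \<X>"
    show "D x y \<in> \<X>" using D[OF x y] .
    {
      fix x' assume x': "x' \<in> \<X>"
      show "D (x + x') y = D x y + D x' y"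
        by (rule field_eqI)
          (simp_all only: calculus GD D x x' y K_add1[OF x y _ x' h] distrib_left)
    }
    {
      fix y' assume y': "y' \<in> \<X>"
      show "D x (y + y') = D x y + D x y'"
        by (rule field_eqI)
          (simp_all only: calculus GD D x y' y K_add2[OF x y _ y' h] distrib_left)
    }
    {
      fix f assume f: "f \<in> \<C>"
      show "D (f *\<^sub>F x) y = f *\<^sub>F D x y"
        by (rule field_eqI)
          (simp_all only: calculus GD D x f y K_scale1[OF x y _ x f] mult.left_commute)
      show "D x (f *\<^sub>F y) = dir_deriv x f *\<^sub>F y + f *\<^sub>F D x y"
      proof (rule field_eqI)
        fix z assume z: "z \<in> \<X>"
        have "?h * (f * K x y z + 2 * dir_deriv x f * G y z) = dir_deriv x f * G y z + f * (?h * K x y z)"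
          by (rule ext) (simp add: algebra_simps)
        then show "G (D x (f *\<^sub>F y)) z = G (dir_deriv x f *\<^sub>F y + f *\<^sub>F D x y) z"
          by (simp only: calculus GD D x f y z K_scale2[OF x y z x f])
      qed (simp_all only: calculus D x f y)
    }
  next
    fix x y assume "x \<notin> \<X> \<or> y \<notin> \<X>"
    then show "D x y = 0" by (auto simp: D_def)
  qed
  moreover have "D x y - D y x = B x y" if x: "x \<in> \<X>" and y: "y \<in> \<X>" for x y
  proof (rule field_eqI)
    fix z assume z: "z \<in> \<X>"
    show "G (D x y - D y x) z = G (B x y) z"
    proof
      fix p
      show "G (D x y - D y x) z p = G (B x y) z p"
        using K_skew[OF x y z x h, of p] by (simp add: G_diff_left GD D x y z)
    qed
  qed (simp_all only: D x y B_field vector_field_diff)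
  moreover have "cov_deriv_metric D g x y z = 0" if x: "x \<in> \<X>" and y: "y \<in> \<X>" and z: "z \<in> \<X>" for x y z
  proof
    fix p
    show "cov_deriv_metric D g x y z p = 0 p"
      unfolding cov_deriv_metric_def G_commute[OF y D[OF x z]]
      using K_metric[OF x y z x h, of p] by (simp add: GD x y z)
  qed
  ultimately show "\<exists>D. linear_connection A D \<and> (\<forall>x\<in>\<X>. \<forall>y\<in>\<X>. D x y - D y x = B x y) \<and>
     (\<forall>x\<in>\<X>. \<forall>y\<in>\<X>. \<forall>z\<in>\<X>. cov_deriv_metric D g x y z = 0)"
    by blast
next
  fix D D'
  assume D: "linear_connection A D \<and> (\<forall>x\<in>\<X>. \<forall>y\<in>\<X>. D x y - D y x = B x y) \<and>
     (\<forall>x\<in>\<X>. \<forall>y\<in>\<X>. \<forall>z\<in>\<X>. cov_deriv_metric D g x y z = 0)"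
    and D': "linear_connection A D' \<and> (\<forall>x\<in>\<X>. \<forall>y\<in>\<X>. D' x y - D' y x = B x y) \<and>
     (\<forall>x\<in>\<X>. \<forall>y\<in>\<X>. \<forall>z\<in>\<X>. cov_deriv_metric D' g x y z = 0)"
  have field: "E x y \<in> \<X>" if "linear_connection A E" "x \<in> \<X>" "y \<in> \<X>" for E x y
    using that unfolding linear_connection_def by blast
  have outside: "E x y = 0" if "linear_connection A E" "x \<notin> \<X> \<or> y \<notin> \<X>" for E x y
    using that unfolding linear_connection_def by blast
  have koszul: "G (E x y) z = (\<lambda>_. 1 / 2) * K x y z"
    if "linear_connection A E \<and> (\<forall>x\<in>\<X>. \<forall>y\<in>\<X>. E x y - E y x = B x y) \<and>
     (\<forall>x\<in>\<X>. \<forall>y\<in>\<X>. \<forall>z\<in>\<X>. cov_deriv_metric E g x y z = 0)"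
      "x \<in> \<X>" "y \<in> \<X>" "z \<in> \<X>" for E x y z
  proof -
    have E: "linear_connection A E" "\<forall>x\<in>\<X>. \<forall>y\<in>\<X>. E x y - E y x = B x y"
      "\<forall>x\<in>\<X>. \<forall>y\<in>\<X>. \<forall>z\<in>\<X>. cov_deriv_metric E g x y z = 0"
      using that(1) by (blast dest: conjunct1 conjunct2)+
    show ?thesis
      by (rule koszul_formula[OF field[OF E(1)] E(2)[rule_format] E(3)[rule_format] that(2-4)])
  qed
  \<comment> \<open>On vector fields both sides have the same pairings by the Koszul formula;
    elsewhere the normalisation makes both 0.\<close>
  show "D = D'"
  proof (rule ext, rule ext)
    fix x y
    show "D x y = D' x y"
    proof (cases "x \<in> \<X> \<and> y \<in> \<X>")
      case True
      then have x: "x \<in> \<X>" and y: "y \<in> \<X>" by blast+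
      show ?thesis
        by (rule field_eqI[OF field[OF conjunct1[OF D] x y] field[OF conjunct1[OF D'] x y]])
          (simp only: koszul[OF D x y] koszul[OF D' x y])
    next
      case False
      then have "D x y = 0" "D' x y = 0"
        using outside[OF conjunct1[OF D], of x y] outside[OF conjunct1[OF D'], of x y] by blast+
      then show ?thesis by simp
    qed
  qed
qed

end

section \<open>The prescribed torsion on an almost paracontact almost paracomplex manifold\<close>

context apapR_manifold
begin

sublocale smooth_riemannian_manifold A g
  by unfold_locales (fact atlas, fact metric)

definition torsion_form :: "('a \<Rightarrow> real) \<Rightarrow> ('a \<Rightarrow> real) \<Rightarrow> 'a vfield \<Rightarrow> 'a vfield \<Rightarrow> 'a vfield" where
  "torsion_form \<alpha> \<beta> x y =
     \<alpha> *\<^sub>F ((\<eta> \<odot> x) *\<^sub>F y - (\<eta> \<odot> y) *\<^sub>F x) +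
     \<beta> *\<^sub>F ((\<eta> \<odot> x) *\<^sub>F (\<phi> \<odot> y) - (\<eta> \<odot> y) *\<^sub>F (\<phi> \<odot> x))"

lemma
  assumes "x \<in> \<X>"
  shows eta_smooth: "\<eta> \<odot> x \<in> \<C>" and phi_field: "\<phi> \<odot> x \<in> \<X>"
  using assms eta_form phi_tensor unfolding one_form_def tensor_field_1_1_def by blast+

lemma
  assumes x: "x \<in> \<X>"
  shows eta_scale: "\<eta> \<odot> (f *\<^sub>F x) = f * (\<eta> \<odot> x)"
    and phi_scale: "\<phi> \<odot> (f *\<^sub>F x) = f *\<^sub>F (\<phi> \<odot> x)"
    and eta_add: "y \<in> \<X> \<Longrightarrow> \<eta> \<odot> (x + y) = \<eta> \<odot> x + \<eta> \<odot> y"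
    and phi_add: "y \<in> \<X> \<Longrightarrow> \<phi> \<odot> (x + y) = \<phi> \<odot> x + \<phi> \<odot> y"
proof -
  have \<eta>: "linear_on_subspace (TS p) (\<eta> p)" and \<phi>: "linear_on_subspace (TS p) (\<phi> p)" for p
    using eta_form phi_tensor unfolding one_form_def tensor_field_1_1_def by blast+
  note xp = vector_fieldsD(1)[OF x]
  have "\<eta> p (f p *\<^sub>R x p) = f p *\<^sub>R \<eta> p (x p)" "\<phi> p (f p *\<^sub>R x p) = f p *\<^sub>R \<phi> p (x p)" for p
    using \<eta>[of p] \<phi>[of p] xp[of p] unfolding linear_on_subspace_def by blast+
  note scale = this
  show "\<eta> \<odot> (f *\<^sub>F x) = f * (\<eta> \<odot> x)"
    by (rule ext) (simp only: scale apply_field_def fun_scale_apply times_fun_apply real_scaleR_def)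
  show "\<phi> \<odot> (f *\<^sub>F x) = f *\<^sub>F (\<phi> \<odot> x)"
    by (rule ext) (simp only: scale apply_field_def fun_scale_apply)
  assume y: "y \<in> \<X>"
  have "\<eta> p (x p + y p) = \<eta> p (x p) + \<eta> p (y p)" "\<phi> p (x p + y p) = \<phi> p (x p) + \<phi> p (y p)" for p
    using \<eta>[of p] \<phi>[of p] xp[of p] vector_fieldsD(1)[OF y, of p] unfolding linear_on_subspace_def by blast+
  note add = this
  show "\<eta> \<odot> (x + y) = \<eta> \<odot> x + \<eta> \<odot> y"
    by (rule ext) (simp add: add apply_field_def)
  show "\<phi> \<odot> (x + y) = \<phi> \<odot> x + \<phi> \<odot> y"
    by (intro ext) (simp add: add apply_field_def)
qed

lemma leibniz_bracket:
  assumes "\<alpha> \<in> \<C>" "\<beta> \<in> \<C>"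
  shows "leibniz_bracket A g (\<lambda>x y. lie_bracket x y + torsion_form \<alpha> \<beta> x y)"
proof unfold_locales
  fix x y assume x: "x \<in> \<X>" and y: "y \<in> \<X>"
  show "lie_bracket x y + torsion_form \<alpha> \<beta> x y \<in> \<X>"
    unfolding torsion_form_def
    by (intro vector_field_add vector_field_diff vector_field_fun_scale lie_bracket_field
        phi_field eta_smooth x y assms)
  have "torsion_form \<alpha> \<beta> y x = - torsion_form \<alpha> \<beta> x y"
    unfolding torsion_form_def by (intro ext) (simp add: algebra_simps)
  then show "lie_bracket y x + torsion_form \<alpha> \<beta> y x = - (lie_bracket x y + torsion_form \<alpha> \<beta> x y)"
    by (simp only: lie_bracket_commute[of y x] minus_add_distrib)
  {
    fix z assume z: "z \<in> \<X>"
    have "torsion_form \<alpha> \<beta> x (y + z) = torsion_form \<alpha> \<beta> x y + torsion_form \<alpha> \<beta> x z"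
      unfolding torsion_form_def eta_add[OF y z] phi_add[OF y z] by (intro ext) (simp add: algebra_simps)
    then show "lie_bracket x (y + z) + torsion_form \<alpha> \<beta> x (y + z) =
        lie_bracket x y + torsion_form \<alpha> \<beta> x y + (lie_bracket x z + torsion_form \<alpha> \<beta> x z)"
      by (simp only: lie_bracket_add[OF x y z] add.assoc add.left_commute)
  }
  {
    fix f assume f: "f \<in> \<C>"
    \<comment> \<open>The torsion is tensorial, so the only derivative of \<open>f\<close> comes
      from the Lie bracket.\<close>
    have "torsion_form \<alpha> \<beta> x (f *\<^sub>F y) = f *\<^sub>F torsion_form \<alpha> \<beta> x y"
      unfolding torsion_form_def eta_scale[OF y] phi_scale[OF y] by (intro ext) (simp add: algebra_simps)
    moreover have "f *\<^sub>F (X + Y) = f *\<^sub>F X + f *\<^sub>F Y" for X Y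
      by (intro ext) (simp add: algebra_simps)
    ultimately show "lie_bracket x (f *\<^sub>F y) + torsion_form \<alpha> \<beta> x (f *\<^sub>F y) =
        dir_deriv x f *\<^sub>F y + f *\<^sub>F (lie_bracket x y + torsion_form \<alpha> \<beta> x y)"
      by (simp only: lie_bracket_fun_scale[OF x y f] add.assoc)
  }
qed

end

theorem theorem1:
  fixes n :: nat
    and A :: "('a::{t2_space, second_countable_topology}, 'e::euclidean_space) chart set"
    and \<phi> :: "'a \<Rightarrow> 'a tvec \<Rightarrow> 'a tvec"
    and \<xi> :: "'a vfield"
    and \<eta> :: "'a \<Rightarrow> 'a tvec \<Rightarrow> real"
    and g :: "'a \<Rightarrow> 'a tvec \<Rightarrow> 'a tvec \<Rightarrow> real"
    and \<alpha> \<beta> :: "'a \<Rightarrow> real"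
  assumes "apapR_manifold n A \<phi> \<xi> \<eta> g"
    and "\<alpha> \<in> smooth_functions A" and "\<beta> \<in> smooth_functions A"
  shows "\<exists>!D. linear_connection A D \<and>
     (\<forall>x\<in>vector_fields A. \<forall>y\<in>vector_fields A.
        D x y - D y x - lie_bracket x y =
          \<alpha> *\<^sub>F ((\<eta> \<odot> x) *\<^sub>F y - (\<eta> \<odot> y) *\<^sub>F x) +
          \<beta> *\<^sub>F ((\<eta> \<odot> x) *\<^sub>F (\<phi> \<odot> y) - (\<eta> \<odot> y) *\<^sub>F (\<phi> \<odot> x))) \<and>
     (\<forall>x\<in>vector_fields A. \<forall>y\<in>vector_fields A. \<forall>z\<in>vector_fields A.
        cov_deriv_metric D g x y z = 0)"
proof -
  interpret apapR_manifold n A \<phi> \<xi> \<eta> g by (fact assms(1))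
  interpret leibniz_bracket A g "\<lambda>x y. lie_bracket x y + torsion_form \<alpha> \<beta> x y"
    by (rule leibniz_bracket[OF assms(2,3)])
  \<comment> \<open>The torsion equation is solved for \<open>D x y - D y x\<close>, which moves the
    Lie bracket to the right and gives the bracket of the interpretation.\<close>
  show ?thesis
    using metric_connection_with_bracket
    unfolding torsion_form_def diff_eq_eq[of _ "lie_bracket _ _"] add.commute[of "lie_bracket _ _"] .
qed

end
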